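(* Let $p\ne2$ be a prime and let $0\le i\le p^f-2$. Define $$F_i(x)=\sum_{m\ge0}\frac{\left(\omega(\phi)^i-(-1)^m\omega(\bar\phi)^i\right)\left(\log_p\frac{\phi}{\omega(\phi)}\right)^m}{m!\,\sqrt5}\,x^m .$$ Then this series defines a function $F_i:\mathbb{Z}_p\to\mathbb{Z}_p$, and with $A_i=\{n\ge0:n\equiv i\pmod{p^f-1}\}$, the family $\{(F_i,A_i):0\le i\le p^f-2\}$ is a twisted interpolation of the Fibonacci sequence $F(n)_{n\ge0}$ to $\mathbb{Z}_p$; that is, each $F_i$ is continuous and $F(n)=F_i(n)$ for all $n\in A_i$.
   Context: $F(0)=0$, $F(1)=1$, $F(n+2)=F(n+1)+F(n)$. Let $K=\mathbb{Q}_p(\phi)$ where $\phi,\bar\phi$ are the two roots of $x^2-x-1$, and $\sqrt5:=2\phi-1$. Let $|\cdot|_p$ be the unique extension to $K$ of the $p$-adic absolute value, $e$ the ramification index, $d=[K:\mathbb{Q}_p]$, $f=d/e$, and $\pi$ a uniformizer (an element with $|\pi|_p=p^{-1/e}$). The residue field of $\mathcal O_K=\{x:|x|_p\le1\}$ has $p^f$ elements; for $x\in\mathcal O_K$, $x\not\equiv0\pmod\pi$, $\omega(x)$ is the unique $(p^f-1)$-st root of unity in $\mathcal O_K$ congruent to $x$ modulo $\pi$. $\log_p y=\sum_{m\ge1}(-1)^{m+1}(y-1)^m/m$ is the $p$-adic logarithm, defined for $|y-1|_p<1$. *)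

theory Defs
  imports Complex_Main "HOL-Number_Theory.Number_Theory"
begin

definition padic_closure_rat :: "('k::field_char_0 \<Rightarrow> real) \<Rightarrow> 'k set" where
  "padic_closure_rat nabs = {x. \<forall>e>0. \<exists>q::rat. nabs (x - of_rat q) < e}"

text \<open>Z_p inside K: the closure of the integers.\<close>
definition padic_closure_int :: "('k::field_char_0 \<Rightarrow> real) \<Rightarrow> 'k set" where
  "padic_closure_int nabs = {x. \<forall>e>0. \<exists>n::int. nabs (x - of_int n) < e}"

definition is_Qp_phi :: "nat \<Rightarrow> ('k::field_char_0 \<Rightarrow> real) \<Rightarrow> 'k \<Rightarrow> bool" where
  "is_Qp_phi p nabs phi \<longleftrightarrow>
     (\<forall>x. nabs x \<ge> 0 \<and> (nabs x = 0 \<longleftrightarrow> x = 0)) \<and>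
     (\<forall>x y. nabs (x * y) = nabs x * nabs y) \<and>
     (\<forall>x y. nabs (x + y) \<le> max (nabs x) (nabs y)) \<and>
     (\<forall>n::int. n \<noteq> 0 \<longrightarrow>
        nabs (of_int n) = real p powr (- real (multiplicity (int p) n))) \<and>
     (\<forall>X::nat \<Rightarrow> 'k. (\<forall>e>0. \<exists>N. \<forall>m\<ge>N. \<forall>n\<ge>N. nabs (X m - X n) < e)
        \<longrightarrow> (\<exists>L. (\<lambda>n. nabs (X n - L)) \<longlonglongrightarrow> 0)) \<and>
     phi^2 = phi + 1 \<and>
     (\<forall>x. \<exists>a b. a \<in> padic_closure_rat nabs \<and> b \<in> padic_closure_rat nabs \<and> x = a + b * phi)"

definition ksums :: "('k::field_char_0 \<Rightarrow> real) \<Rightarrow> (nat \<Rightarrow> 'k) \<Rightarrow> 'k \<Rightarrow> bool" where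
  "ksums nabs f s \<longleftrightarrow> (\<lambda>n. nabs ((\<Sum>k<n. f k) - s)) \<longlonglongrightarrow> 0"

definition ksuminf :: "('k::field_char_0 \<Rightarrow> real) \<Rightarrow> (nat \<Rightarrow> 'k) \<Rightarrow> 'k" where
  "ksuminf nabs f = (THE s. ksums nabs f s)"

text \<open>Number of elements p^f of the residue field O_K / (pi).\<close>
definition res_card :: "('k::field_char_0 \<Rightarrow> real) \<Rightarrow> nat" where
  "res_card nabs = card ({x. nabs x \<le> 1} //
      {(x, y). nabs x \<le> 1 \<and> nabs y \<le> 1 \<and> nabs (x - y) < 1})"

definition teich :: "('k::field_char_0 \<Rightarrow> real) \<Rightarrow> 'k \<Rightarrow> 'k" where
  "teich nabs x = (THE z. nabs z \<le> 1 \<and> z ^ (res_card nabs - 1) = 1 \<and> nabs (z - x) < 1)"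

definition plog :: "('k::field_char_0 \<Rightarrow> real) \<Rightarrow> 'k \<Rightarrow> 'k" where
  "plog nabs y = ksuminf nabs (\<lambda>m. (-1) ^ m * (y - 1) ^ (m + 1) / of_nat (m + 1))"

text \<open>The m-th coefficient of F_i; phibar = 1 - phi, sqrt5 = 2 phi - 1.\<close>
definition Fi_coeff :: "('k::field_char_0 \<Rightarrow> real) \<Rightarrow> 'k \<Rightarrow> nat \<Rightarrow> nat \<Rightarrow> 'k" where
  "Fi_coeff nabs phi i m =
     (teich nabs phi ^ i - (-1) ^ m * teich nabs (1 - phi) ^ i)
       * (plog nabs (phi / teich nabs phi)) ^ m
       / (of_nat (fact m) * (2 * phi - 1))"

definition Fi :: "('k::field_char_0 \<Rightarrow> real) \<Rightarrow> 'k \<Rightarrow> nat \<Rightarrow> 'k \<Rightarrow> 'k" where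
  "Fi nabs phi i x = ksuminf nabs (\<lambda>m. Fi_coeff nabs phi i m * x ^ m)"

end

theory Submission
  imports Defs
begin

text \<open>
  Write \<open>q\<close> for the order of the residue field and \<open>omega\<close> for the Teichmueller representative of
  \<open>phi\<close>. The principal unit \<open>y = phi / omega\<close> satisfies \<open>y = exp (log y)\<close>, and \<open>phi * (1 - phi) = -1\<close>
  forces the Teichmueller representative of \<open>1 - phi\<close> to be \<open>-1 / omega\<close>. Hence the series sums to
  \<open>(omega ^ i * exp (x * log y) - (-1 / omega) ^ i * exp (- x * log y)) / sqrt 5\<close>, which is Lipschitz
  on the unit ball and, by Binet's formula, equals \<open>fib n\<close> at every \<open>x = n\<close> with \<open>n \<equiv> i\<close> modulo \<open>q - 1\<close>.
  These \<open>n\<close> are dense in the \<open>p\<close>-adic integers because \<open>q - 1\<close> is prime to \<open>p\<close>, so the values are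
  \<open>p\<close>-adic integers.

  All convergence statements rest on one estimate: \<open>nabs x < 1\<close> implies \<open>nabs x ^ (p - 1) \<le> 1 / p\<^sup>2\<close>,
  that is, the ramification index is at most \<open>(p - 1) / 2\<close>. It holds because \<open>K\<close> is unramified
  for \<open>p \<noteq> 5\<close> and has ramification index \<open>2\<close> for \<open>p = 5\<close>.
\<close>

section \<open>Complete ultrametric fields and the exponential and logarithm series\<close>

locale ultrametric_field =
  fixes nabs :: "'k::field_char_0 \<Rightarrow> real"
  assumes nabs_nonneg [simp]: "0 \<le> nabs x"
    and nabs_eq_0_iff [simp]: "nabs x = 0 \<longleftrightarrow> x = 0"
    and nabs_mult: "nabs (x * y) = nabs x * nabs y"
    and nabs_add_le: "nabs (x + y) \<le> max (nabs x) (nabs y)"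
begin

lemma nabs_0 [simp]: "nabs 0 = 0"
  by simp

lemma nabs_pos_iff [simp]: "0 < nabs x \<longleftrightarrow> x \<noteq> 0"
  using nabs_nonneg[of x] nabs_eq_0_iff[of x] by (auto simp: less_le)

lemma nabs_1 [simp]: "nabs 1 = 1"
proof -
  have "nabs 1 * nabs 1 = nabs 1 * 1" using nabs_mult[of 1 1] by simp
  moreover have "nabs 1 \<noteq> 0" by simp
  ultimately show ?thesis by (metis mult_cancel_left)
qed

lemma nabs_minus [simp]: "nabs (- x) = nabs x"
proof -
  have "nabs (-1) * nabs (-1) = 1" using nabs_mult[of "-1" "-1"] by simp
  then have "nabs (-1) = 1"
    using nabs_nonneg[of "-1"] by (metis abs_of_nonneg abs_1 power2_eq_square power2_eq_1_iff abs_minus)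
  then show ?thesis using nabs_mult[of "-1" x] by simp
qed

lemma nabs_power: "nabs (x ^ n) = nabs x ^ n"
  by (induction n) (auto simp: nabs_mult)

lemma nabs_minus_one_power [simp]: "nabs ((-1) ^ n) = 1"
  by (simp add: nabs_power)

lemma nabs_inverse: "nabs (inverse x) = inverse (nabs x)"
proof (cases "x = 0")
  case False
  then have "nabs x * nabs (inverse x) = 1" using nabs_mult[of x "inverse x"] by simp
  then show ?thesis by (simp add: inverse_unique)
qed simp

lemma nabs_divide: "nabs (x / y) = nabs x / nabs y"
  by (simp add: divide_inverse nabs_mult nabs_inverse)

lemma nabs_minus_commute: "nabs (x - y) = nabs (y - x)"
  using nabs_minus[of "x - y"] by simp

lemma nabs_diff_le: "nabs (x - y) \<le> max (nabs x) (nabs y)"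
  using nabs_add_le[of x "- y"] by simp

lemma nabs_add_bound: "nabs x \<le> B \<Longrightarrow> nabs y \<le> B \<Longrightarrow> nabs (x + y) \<le> B"
  using nabs_add_le[of x y] by linarith

lemma nabs_add_less: "nabs x < B \<Longrightarrow> nabs y < B \<Longrightarrow> nabs (x + y) < B"
  using nabs_add_le[of x y] by linarith

lemma nabs_diff_bound: "nabs x \<le> B \<Longrightarrow> nabs y \<le> B \<Longrightarrow> nabs (x - y) \<le> B"
  using nabs_diff_le[of x y] by linarith

lemma nabs_diff_less: "nabs x < B \<Longrightarrow> nabs y < B \<Longrightarrow> nabs (x - y) < B"
  using nabs_diff_le[of x y] by linarith

lemma nabs_diff_trans_le: "nabs (x - y) \<le> B \<Longrightarrow> nabs (y - z) \<le> B \<Longrightarrow> nabs (x - z) \<le> B"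
  using nabs_add_bound[of "x - y" B "y - z"] by simp

lemma nabs_diff_trans_less: "nabs (x - y) < B \<Longrightarrow> nabs (y - z) < B \<Longrightarrow> nabs (x - z) < B"
  using nabs_add_less[of "x - y" B "y - z"] by simp

text \<open>The larger term wins: \<open>x = (x + y) - y\<close> bounds \<open>nabs x\<close> by the
  maximum of \<open>nabs (x + y)\<close> and \<open>nabs y\<close>, and the latter is too small to
  attain it.\<close>

lemma nabs_add_eq_left:
  assumes "nabs y < nabs x"
  shows "nabs (x + y) = nabs x"
  using nabs_add_le[of x y] nabs_diff_le[of "x + y" y] assms by auto

lemma nabs_eq_if_close:
  assumes "nabs (x - y) < nabs x"
  shows "nabs y = nabs x"
  using nabs_add_eq_left[of "y - x" x] assms by (simp add: nabs_minus_commute)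

lemma nabs_eq_1_if_close_1: "nabs (x - 1) < 1 \<Longrightarrow> nabs x = 1"
  using nabs_eq_if_close[of 1 x] by (simp add: nabs_minus_commute)

lemma nabs_sum_le:
  assumes "\<And>i. i \<in> A \<Longrightarrow> nabs (f i) \<le> B" and "0 \<le> B"
  shows "nabs (sum f A) \<le> B"
proof (cases "finite A")
  case True
  then show ?thesis using assms
    by (induction A rule: finite_induct) (auto intro!: nabs_add_bound)
qed (use assms in simp)

lemma nabs_of_nat_le_1: "nabs (of_nat n) \<le> 1"
  by (induction n) (auto intro!: nabs_add_bound)

lemma nabs_of_int_le_1: "nabs (of_int n) \<le> 1"
  by (cases n rule: int_cases2) (simp_all add: nabs_of_nat_le_1)

text \<open>Powers respect congruence modulo the maximal ideal; this is how congruences are carried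
  through the Frobenius map below.\<close>

lemma nabs_power_diff_le:
  assumes "nabs x \<le> 1" "nabs y \<le> 1"
  shows "nabs (x ^ n - y ^ n) \<le> nabs (x - y)"
proof (induction n)
  case (Suc n)
  have "x ^ Suc n - y ^ Suc n = x * (x ^ n - y ^ n) + (x - y) * y ^ n"
    by (simp add: algebra_simps)
  moreover have "nabs (x * (x ^ n - y ^ n)) \<le> nabs (x - y)"
    using mult_mono[OF assms(1) Suc] by (simp add: nabs_mult)
  moreover have "nabs ((x - y) * y ^ n) \<le> nabs (x - y)"
    using assms by (simp add: nabs_mult nabs_power mult_left_le power_le_one)
  ultimately show ?case by (simp add: nabs_add_bound)
qed simp

section \<open>Series in an ultrametric field\<close>

lemma ksums_unique:
  assumes "ksums nabs f s" "ksums nabs f s'"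
  shows "s = s'"
proof (rule ccontr)
  assume "s \<noteq> s'"
  then have pos: "nabs (s - s') > 0" by simp
  obtain N1 where "\<And>n. n \<ge> N1 \<Longrightarrow> nabs (sum f {..<n} - s) < nabs (s - s')"
    using order_tendstoD(2)[OF assms(1)[unfolded ksums_def] pos] unfolding eventually_sequentially by blast
  moreover obtain N2 where "\<And>n. n \<ge> N2 \<Longrightarrow> nabs (sum f {..<n} - s') < nabs (s - s')"
    using order_tendstoD(2)[OF assms(2)[unfolded ksums_def] pos] unfolding eventually_sequentially by blast
  ultimately have "nabs (s - s') < nabs (s - s')"
    using nabs_diff_trans_less[of s "sum f {..<max N1 N2}" _ s'] nabs_minus_commute
    by (metis max.cobounded1 max.cobounded2)
  then show False by simp
qed

lemma ksuminf_eqI: "ksums nabs f s \<Longrightarrow> ksuminf nabs f = s"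
  unfolding ksuminf_def using ksums_unique by blast

text \<open>Closed balls contain the limits of their sequences. If \<open>s\<close> were farther
  than \<open>B\<close> from \<open>c\<close>, some partial sum would be closer than
  \<open>nabs (s - c)\<close> to both, which the ultrametric inequality forbids.\<close>

lemma ksums_diff_bound:
  assumes "ksums nabs f s" and "\<forall>\<^sub>F n in sequentially. nabs ((\<Sum>k<n. f k) - c) \<le> B" and "0 \<le> B"
  shows "nabs (s - c) \<le> B"
proof (rule ccontr)
  assume "\<not> nabs (s - c) \<le> B"
  then have pos: "nabs (s - c) > 0" and gt: "B < nabs (s - c)" using assms(3) by linarith+
  have "\<forall>\<^sub>F n in sequentially. nabs ((\<Sum>k<n. f k) - s) < nabs (s - c)"
    using order_tendstoD(2)[OF assms(1)[unfolded ksums_def] pos] .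
  with assms(2) have "\<forall>\<^sub>F n in sequentially. False"
  proof eventually_elim
    case (elim n)
    then have "nabs (s - c) < nabs (s - c)"
      using gt nabs_diff_trans_less[of s "\<Sum>k<n. f k" "nabs (s - c)" c]
      by (simp add: nabs_minus_commute[of s])
    then show False by simp
  qed
  then show False by simp
qed

lemma ksums_bound:
  assumes "ksums nabs f s" "\<And>n. nabs (f n) \<le> B"
  shows "nabs s \<le> B"
proof -
  have "0 \<le> B" using assms(2)[of 0] nabs_nonneg[of "f 0"] by linarith
  then show ?thesis
    using ksums_diff_bound[OF assms(1), of 0 B] assms(2) by (simp add: nabs_sum_le)
qed

lemma ksums_cmult:
  assumes "ksums nabs f s"
  shows "ksums nabs (\<lambda>n. c * f n) (c * s)"
proof -
  have "nabs ((\<Sum>k<n. c * f k) - c * s) = nabs c * nabs ((\<Sum>k<n. f k) - s)" for n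
    by (simp add: sum_distrib_left[symmetric] right_diff_distrib[symmetric] nabs_mult)
  then show ?thesis
    using tendsto_mult_right_zero[OF assms[unfolded ksums_def], of "nabs c"] by (simp add: ksums_def)
qed

lemma ksums_add:
  assumes "ksums nabs f s" "ksums nabs g s'"
  shows "ksums nabs (\<lambda>n. f n + g n) (s + s')"
  unfolding ksums_def
proof (rule tendsto_sandwich[OF always_eventually _ tendsto_const])
  let ?h = "\<lambda>n. nabs ((\<Sum>k<n. f k) - s) + nabs ((\<Sum>k<n. g k) - s')"
  show "?h \<longlonglongrightarrow> 0"
    using tendsto_add[OF assms[unfolded ksums_def]] by simp
  show "\<forall>\<^sub>F n in sequentially. nabs ((\<Sum>k<n. f k + g k) - (s + s')) \<le> ?h n"
  proof (rule always_eventually, rule allI)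
    fix n
    have "(\<Sum>k<n. f k + g k) - (s + s') = ((\<Sum>k<n. f k) - s) + ((\<Sum>k<n. g k) - s')"
      by (simp add: sum.distrib)
    moreover have "nabs u + nabs v \<ge> max (nabs u) (nabs v)" for u v by simp
    ultimately show "nabs ((\<Sum>k<n. f k + g k) - (s + s')) \<le> ?h n"
      by (metis nabs_add_le order_trans)
  qed
qed simp

lemma ksums_diff:
  assumes "ksums nabs f s" "ksums nabs g s'"
  shows "ksums nabs (\<lambda>n. f n - g n) (s - s')"
  using ksums_add[OF assms(1) ksums_cmult[OF assms(2), of "-1"]] by simp

end

locale complete_ultrametric_field = ultrametric_field nabs
  for nabs :: "'k::field_char_0 \<Rightarrow> real" +
  assumes nabs_complete: "(\<forall>e>0. \<exists>N. \<forall>m\<ge>N. \<forall>n\<ge>N. nabs (X m - X n) < e) \<Longrightarrow>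
    \<exists>L. (\<lambda>n. nabs (X n - L)) \<longlonglongrightarrow> 0"
begin

text \<open>Terms tending to 0 suffice here: a block of the series is bounded by its largest term,
  so the partial sums are Cauchy.\<close>

lemma ksums_ksuminf:
  assumes "(\<lambda>n. nabs (f n)) \<longlonglongrightarrow> 0"
  shows "ksums nabs f (ksuminf nabs f)"
proof -
  have "\<exists>N. \<forall>m\<ge>N. \<forall>n\<ge>N. nabs (sum f {..<m} - sum f {..<n}) < e" if "e > 0" for e
  proof -
    obtain N where N: "\<And>n. n \<ge> N \<Longrightarrow> nabs (f n) < e / 2"
      using order_tendstoD(2)[OF assms, of "e / 2"] \<open>e > 0\<close>
      unfolding eventually_sequentially by auto
    have *: "nabs (sum f {..<n} - sum f {..<N}) \<le> e / 2" if "n \<ge> N" for n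
    proof -
      have "sum f {..<n} - sum f {..<N} = sum f {N..<n}"
        using sum_diff_nat_ivl[of 0 N n f] that by (simp add: atLeast0LessThan)
      then show ?thesis
        using nabs_sum_le[of "{N..<n}" f "e / 2"] N \<open>e > 0\<close> by (simp add: less_imp_le)
    qed
    have "nabs (sum f {..<m} - sum f {..<n}) < e" if "m \<ge> N" "n \<ge> N" for m n
      using nabs_diff_trans_le[OF *[OF that(1)], of "sum f {..<n}"] *[OF that(2)] \<open>e > 0\<close>
      by (simp add: nabs_minus_commute[of "sum f {..<N}"])
    then show ?thesis by blast
  qed
  then obtain s where "ksums nabs f s"
    using nabs_complete[of "\<lambda>n. sum f {..<n}"] by (auto simp: ksums_def)
  then show ?thesis using ksuminf_eqI by metis
qed

lemma ksums_ksuminf_geometric: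
  assumes "\<And>n. nabs (f n) \<le> C * r ^ n" "0 \<le> r" "r < 1"
  shows "ksums nabs f (ksuminf nabs f)"
proof (rule ksums_ksuminf)
  have "(\<lambda>n. C * r ^ n) \<longlonglongrightarrow> 0"
    using tendsto_mult_right_zero[OF LIMSEQ_power_zero[of r], of C] assms by simp
  then show "(\<lambda>n. nabs (f n)) \<longlonglongrightarrow> 0"
    by (rule tendsto_sandwich[OF _ _ tendsto_const, rotated 2]) (use assms in simp_all)
qed

end

section \<open>Absolute values of integers and factorials\<close>

locale padic_field = complete_ultrametric_field nabs
  for nabs :: "'k::field_char_0 \<Rightarrow> real" +
  fixes p :: nat
  assumes prime_p: "prime p"
    and nabs_of_int: "n \<noteq> 0 \<Longrightarrow> nabs (of_int n) = real p powr (- real (multiplicity (int p) n))"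
begin

lemma p_gt_1: "p > 1"
  using prime_p prime_gt_1_nat by blast

lemma p_pos [simp]: "p > 0"
  using p_gt_1 by simp

lemma nabs_p: "nabs (of_nat p) = 1 / real p"
proof -
  have "nabs (of_int (int p)) = 1 / real p"
    using nabs_of_int[of "int p"] p_gt_1 multiplicity_self[of "int p"]
    by (simp add: powr_minus_divide)
  then show ?thesis by simp
qed

lemma nabs_of_int_eq_1:
  assumes "\<not> int p dvd n"
  shows "nabs (of_int n) = 1"
proof -
  have "n \<noteq> 0" using assms by auto
  then show ?thesis using nabs_of_int[of n] assms p_gt_1 by (simp add: not_dvd_imp_multiplicity_0)
qed

lemma nabs_of_int_less_1_iff: "nabs (of_int n) < 1 \<longleftrightarrow> int p dvd n"
proof
  show "nabs (of_int n) < 1 \<Longrightarrow> int p dvd n" using nabs_of_int_eq_1 by force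
next
  assume "int p dvd n"
  then obtain m where "n = int p * m" by auto
  then have "nabs (of_int n) = 1 / real p * nabs (of_int m)" by (simp add: nabs_mult nabs_p)
  also have "\<dots> \<le> 1 / real p * 1" using nabs_of_int_le_1 by (intro mult_left_mono) auto
  also have "\<dots> < 1" using p_gt_1 by simp
  finally show "nabs (of_int n) < 1" .
qed

lemma nabs_of_nat_eq_1: "\<not> p dvd n \<Longrightarrow> nabs (of_nat n) = 1"
  using nabs_of_int_eq_1[of "int n"] by simp

text \<open>The exact power of \<open>p\<close> dividing \<open>n\<close> is at most
  \<open>n\<close>. This crude Archimedean bound limits the cost of a division in
  \<open>nabs_binomial_minus_sign_le\<close>.\<close>

lemma nabs_of_nat_ge:
  assumes "n > 0"
  shows "1 / real n \<le> nabs (of_nat n)"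
proof -
  define v where "v = multiplicity (int p) (int n)"
  have "int p ^ v dvd int n" unfolding v_def by (rule multiplicity_dvd)
  then have "p ^ v dvd n" by (metis of_nat_dvd_iff of_nat_power)
  then have le: "p ^ v \<le> n" using assms by (simp add: dvd_imp_le)
  have "nabs (of_nat n) = real p powr - real v"
    using nabs_of_int[of "int n"] assms by (simp add: v_def)
  also have "\<dots> = 1 / real (p ^ v)"
    using p_gt_1 by (simp add: powr_minus_divide powr_realpow)
  also have "\<dots> \<ge> 1 / real n"
    using le p_gt_1 assms by (intro divide_left_mono) (auto simp del: of_nat_power)
  finally show ?thesis .
qed

text \<open>Legendre's formula as a recursion: among the factors of \<open>m!\<close> only the
  multiples of \<open>p\<close> are not units, and their product is \<open>p ^ (m div p)\<close>
  times the factorial of \<open>m div p\<close>.\<close>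

lemma nabs_fact_step: "nabs (fact m) = (1 / real p) ^ (m div p) * nabs (fact (m div p))"
proof (induction m)
  case (Suc m)
  show ?case
  proof (cases "p dvd Suc m")
    case True
    then obtain c where c: "Suc m = p * c" by auto
    have d: "Suc m div p = Suc (m div p)"
      using True by (simp add: div_Suc dvd_eq_mod_eq_0)
    then have c': "c = Suc (m div p)" using c by simp
    have "nabs (fact (Suc m)) = nabs (of_nat (p * c)) * nabs (fact m)"
      using c by (metis fact_Suc nabs_mult)
    also have "\<dots> = 1 / real p * nabs (of_nat c) * nabs (fact m)"
      by (simp add: nabs_mult nabs_p)
    also have "\<dots> = (1 / real p) ^ c * (nabs (of_nat c) * nabs (fact (m div p)))"
      by (simp add: Suc c' del: of_nat_Suc)
    also have "nabs (of_nat c) * nabs (fact (m div p)) = nabs (fact c)"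
      unfolding c' fact_Suc nabs_mult ..
    finally show ?thesis using d c' by simp
  next
    case False
    then have "Suc m div p = m div p" by (simp add: div_Suc dvd_eq_mod_eq_0)
    moreover have "nabs (of_nat (Suc m)) = 1" using False nabs_of_nat_eq_1 by blast
    ultimately show ?thesis using Suc by (simp only: fact_Suc nabs_mult mult_1)
  qed
qed simp

text \<open>The valuation of \<open>(k + 1)!\<close> is at most \<open>k / (p - 1)\<close>; raising
  to the power \<open>p - 1\<close> avoids the fractional exponent.\<close>

lemma nabs_fact_power_ge: "(1 / real p) ^ k \<le> nabs (fact (Suc k)) ^ (p - 1)"
proof (induction k rule: less_induct)
  case (less k)
  define c where "c = Suc k div p"
  have step: "nabs (fact (Suc k)) ^ (p - 1) = (1 / real p) ^ (c * (p - 1)) * nabs (fact c) ^ (p - 1)"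
    by (simp only: nabs_fact_step[of "Suc k"] c_def power_mult_distrib power_mult)
  show ?case
  proof (cases c)
    case 0
    then show ?thesis using step p_gt_1 by (simp add: power_le_one)
  next
    case (Suc j)
    have cp: "c * p \<le> Suc k" unfolding c_def by simp
    have "j < k" using cp Suc p_gt_1
      by (metis Suc_less_eq le_less_trans less_le_trans mult.right_neutral mult_less_cancel1 not_less zero_less_Suc linorder_not_le)
    then have "(1 / real p) ^ j \<le> nabs (fact c) ^ (p - 1)" using less Suc by simp
    then have "(1 / real p) ^ (c * (p - 1)) * (1 / real p) ^ j \<le> nabs (fact (Suc k)) ^ (p - 1)"
      unfolding step by (intro mult_left_mono) auto
    \<comment> \<open>With \<open>c = j + 1\<close> the exponent is \<open>c * p - 1\<close>, and
      \<open>c * p \<le> k + 1\<close>.\<close>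
    moreover have "c * (p - 1) + j \<le> k"
    proof -
      have "c * (p - 1) + c = c * p" using p_gt_1 by (metis Suc_diff_1 mult_Suc_right add.commute p_pos)
      then show ?thesis using cp Suc by linarith
    qed
    then have "(1 / real p) ^ k \<le> (1 / real p) ^ (c * (p - 1) + j)"
      using p_gt_1 by (intro power_decreasing) auto
    ultimately show ?thesis by (simp add: power_add)
  qed
qed

end

section \<open>The exponential and principal units under low ramification\<close>

locale low_ramification = padic_field nabs p
  for nabs :: "'k::field_char_0 \<Rightarrow> real" and p :: nat +
  assumes nabs_less_1_power: "nabs x < 1 \<Longrightarrow> nabs x ^ (p - 1) \<le> (1 / real p) ^ 2"
begin

text \<open>This is \<open>p\<close> to the power \<open>-1 / (p - 1)\<close>, the radius of
  convergence of the \<open>p\<close>-adic exponential; below it is the ratio of the geometric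
  majorants.\<close>

definition rad :: real where "rad = root (p - 1) (1 / real p)"

lemma rad_power: "rad ^ (p - 1) = 1 / real p"
  using p_gt_1 by (simp add: rad_def)

lemma rad_pos: "0 < rad"
  using p_gt_1 by (simp add: rad_def)

lemma rad_less_1: "rad < 1"
  using p_gt_1 by (simp add: rad_def)

lemma rad_power_le_1: "rad ^ k \<le> 1"
  using rad_pos rad_less_1 by (simp add: power_le_one)

text \<open>Low ramification makes \<open>nabs x ^ k\<close> at most \<open>rad ^ (2 * k)\<close>,
  and the factorial takes back at most one factor \<open>rad ^ k\<close>. The shift to
  \<open>Suc k\<close> keeps one power of \<open>x\<close> in reserve and lets the same bound cover
  the denominators \<open>k!\<close> and \<open>k + 1\<close>.\<close>

lemma nabs_power_div_fact_Suc_le: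
  assumes "nabs x < 1"
  shows "nabs (x ^ k / fact (Suc k)) \<le> rad ^ k"
proof (rule power_le_imp_le_base)
  have "nabs (x ^ k / fact (Suc k)) ^ (p - 1) = (nabs x ^ (p - 1)) ^ k / nabs (fact (Suc k)) ^ (p - 1)"
    by (simp add: nabs_divide nabs_power power_divide mult.commute del: fact_Suc flip: power_mult)
  also have "\<dots> \<le> ((1 / real p) ^ 2) ^ k / (1 / real p) ^ k"
    using nabs_fact_power_ge[of k] p_gt_1 nabs_less_1_power[OF assms]
    by (intro frac_le power_mono) auto
  also have "\<dots> = (1 / real p) ^ k"
    using p_gt_1 by (simp add: power_divide field_simps power2_eq_square)
  also have "\<dots> = (rad ^ k) ^ (p - 1)"
    by (simp only: rad_power[symmetric] power_mult[symmetric] mult.commute)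
  \<comment> \<open>The rule compares powers whose exponent is a successor; here
    \<open>Suc (p - 2) = p - 1\<close>.\<close>
  finally show "nabs (x ^ k / fact (Suc k)) ^ Suc (p - 2) \<le> (rad ^ k) ^ Suc (p - 2)"
    using p_gt_1 by (metis Suc_diff_Suc numeral_2_eq_2 One_nat_def)
qed (use rad_pos in simp)

lemma nabs_power_div_fact_le:
  assumes "nabs x < 1"
  shows "nabs (x ^ k / fact k) \<le> rad ^ k"
proof -
  have "nabs (x ^ k / fact k) = nabs (of_nat (Suc k)) * nabs (x ^ k / fact (Suc k))"
    unfolding nabs_mult[symmetric] by (simp add: fact_Suc del: of_nat_Suc)
  also have "\<dots> \<le> 1 * rad ^ k"
    using nabs_of_nat_le_1 nabs_power_div_fact_Suc_le[OF assms] by (intro mult_mono) (auto simp del: of_nat_Suc)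
  finally show ?thesis by simp
qed

lemma nabs_power_div_Suc_le:
  assumes "nabs x < 1"
  shows "nabs (x ^ k / of_nat (Suc k)) \<le> rad ^ k"
proof -
  have "nabs (x ^ k / of_nat (Suc k)) = nabs (of_nat (fact k)) * nabs (x ^ k / fact (Suc k))"
    unfolding nabs_mult[symmetric] by (simp add: fact_Suc del: of_nat_Suc)
  also have "\<dots> \<le> 1 * rad ^ k"
    using nabs_of_nat_le_1 nabs_power_div_fact_Suc_le[OF assms] by (intro mult_mono) (auto simp del: of_nat_fact)
  finally show ?thesis by simp
qed

definition kexp :: "'k \<Rightarrow> 'k" where
  "kexp a = ksuminf nabs (\<lambda>m. a ^ m / fact m)"

lemma kexp_sums:
  assumes "nabs a < 1"
  shows "ksums nabs (\<lambda>m. a ^ m / fact m) (kexp a)"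
  unfolding kexp_def
  by (rule ksums_ksuminf_geometric[of _ 1 rad])
    (use nabs_power_div_fact_le[OF assms] rad_pos rad_less_1 in auto)

lemma kexp_0 [simp]: "kexp 0 = 1"
  unfolding kexp_def
proof (rule ksuminf_eqI)
  have "(\<Sum>k<n. 0 ^ k / fact k) = (1 :: 'k)" if "n > 0" for n
    using that by (cases n) (auto simp: sum.lessThan_Suc_shift simp del: sum.lessThan_Suc)
  then have "\<forall>\<^sub>F n in sequentially. nabs ((\<Sum>k<n. 0 ^ k / fact k) - 1) = 0"
    by (auto simp: eventually_sequentially intro!: exI[of _ 1])
  then show "ksums nabs (\<lambda>m. 0 ^ m / fact m) 1"
    unfolding ksums_def by (rule tendsto_eventually)
qed

text \<open>Every term after the first is \<open>a\<close> times a quantity of absolute value at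
  most 1.\<close>

lemma nabs_kexp_minus_1_le:
  assumes "nabs a < 1"
  shows "nabs (kexp a - 1) \<le> nabs a"
proof (rule ksums_diff_bound[OF kexp_sums[OF assms]])
  have "nabs ((\<Sum>k<Suc n. a ^ k / fact k) - 1) \<le> nabs a" for n
  proof -
    have "(\<Sum>k<Suc n. a ^ k / fact k) - 1 = (\<Sum>k<n. a * (a ^ k / fact (Suc k)))"
      by (simp only: sum.lessThan_Suc_shift) simp
    moreover have "nabs (a * (a ^ k / fact (Suc k))) \<le> nabs a" for k
      unfolding nabs_mult using nabs_power_div_fact_Suc_le[OF assms, of k] rad_power_le_1[of k]
      by (intro mult_left_le) (simp_all del: fact_Suc)
    ultimately show ?thesis by (simp add: nabs_sum_le del: fact_Suc)
  qed
  then have "\<forall>n\<ge>1. nabs ((\<Sum>k<n. a ^ k / fact k) - 1) \<le> nabs a"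
    by (metis One_nat_def Suc_le_D)
  then show "\<forall>\<^sub>F n in sequentially. nabs ((\<Sum>k<n. a ^ k / fact k) - 1) \<le> nabs a"
    unfolding eventually_sequentially by blast
qed simp

lemma nabs_kexp: "nabs a < 1 \<Longrightarrow> nabs (kexp a) = 1"
  using nabs_kexp_minus_1_le[of a] by (intro nabs_eq_1_if_close_1) linarith

lemma nabs_of_nat_mult_less_1: "nabs a < 1 \<Longrightarrow> nabs (of_nat n * a) < 1"
  using mult_left_le_one_le[of "nabs a" "nabs (of_nat n)"] nabs_of_nat_le_1[of n]
  by (simp add: nabs_mult)

text \<open>The terms of degree \<open>k \<ge> 2\<close> carry \<open>N ^ k\<close>, and their
  cofactors \<open>a ^ k / fact k\<close> are integral. The bound is uniform in \<open>N\<close>, to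
  be compared with the one for \<open>(1 + x) ^ N\<close> in \<open>plog_approx\<close>.\<close>

lemma kexp_second_order:
  assumes "nabs a < 1"
  shows "nabs (kexp (of_nat N * a) - (1 + of_nat N * a)) \<le> nabs (of_nat N) ^ 2"
proof -
  have small: "nabs (of_nat N * a) < 1" using nabs_of_nat_mult_less_1[OF assms] .
  show ?thesis
  proof (rule ksums_diff_bound[OF kexp_sums[OF small]])
    have "nabs ((\<Sum>k<Suc (Suc n). (of_nat N * a) ^ k / fact k) - (1 + of_nat N * a)) \<le> nabs (of_nat N) ^ 2" for n
    proof -
      have "(\<Sum>k<Suc (Suc n). (of_nat N * a) ^ k / fact k) - (1 + of_nat N * a)
          = (\<Sum>k<n. (of_nat N * a) ^ (Suc (Suc k)) / fact (Suc (Suc k)))"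
        by (simp only: sum.lessThan_Suc_shift) simp
      moreover have "nabs ((of_nat N * a) ^ (Suc (Suc k)) / fact (Suc (Suc k))) \<le> nabs (of_nat N) ^ 2" for k
      proof -
        have "nabs ((of_nat N * a) ^ (Suc (Suc k)) / fact (Suc (Suc k)))
            = nabs (of_nat N) ^ Suc (Suc k) * nabs (a ^ Suc (Suc k) / fact (Suc (Suc k)))"
          unfolding power_mult_distrib nabs_mult nabs_divide nabs_power by simp
        also have "\<dots> \<le> nabs (of_nat N) ^ 2 * 1"
          using nabs_power_div_fact_le[OF assms, of "Suc (Suc k)"] rad_power_le_1[of "Suc (Suc k)"]
          by (intro mult_mono power_decreasing) (simp_all add: nabs_of_nat_le_1 del: fact_Suc power_Suc)
        finally show ?thesis by simp
      qed
      ultimately show ?thesis by (simp add: nabs_sum_le del: fact_Suc)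
    qed
    then have "\<forall>n\<ge>2. nabs ((\<Sum>k<n. (of_nat N * a) ^ k / fact k) - (1 + of_nat N * a)) \<le> nabs (of_nat N) ^ 2"
      by (metis Suc_le_D numeral_2_eq_2 Suc_le_mono)
    then show "\<forall>\<^sub>F n in sequentially. nabs ((\<Sum>k<n. (of_nat N * a) ^ k / fact k) - (1 + of_nat N * a)) \<le> nabs (of_nat N) ^ 2"
      unfolding eventually_sequentially by blast
  qed simp
qed


text \<open>The product of the truncations at \<open>n\<close> differs from the truncation for
  \<open>a + b\<close> only by terms with \<open>i + j \<ge> n\<close>, each of absolute value at
  most \<open>rad ^ n\<close>.\<close>

lemma kexp_add:
  assumes "nabs a < 1" "nabs b < 1"
  shows "kexp (a + b) = kexp a * kexp b"
proof -
  define T where "T c n = (\<Sum>k<n. c ^ k / fact k)" for c :: 'k and n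
  have lim: "(\<lambda>n. nabs (T c n - kexp c)) \<longlonglongrightarrow> 0" if "nabs c < 1" for c
    using kexp_sums[OF that] by (simp add: ksums_def T_def)
  have T_le: "nabs (T c n) \<le> 1" if "nabs c < 1" for c n
    unfolding T_def using order_trans[OF nabs_power_div_fact_le[OF that] rad_power_le_1]
    by (intro nabs_sum_le) auto
  have ab: "nabs (a + b) < 1" using assms by (rule nabs_add_less)
  have trunc: "nabs (T a n * T b n - T (a + b) n) \<le> rad ^ n" for n
  proof -
    define g where "g = (\<lambda>(i, j). (a ^ i / fact i) * (b ^ j / fact j))"
    define S where "S = {(i, j). i + j < n}"
    have S_sub: "S \<subseteq> {..<n} \<times> {..<n}" unfolding S_def by auto
    have "T a n * T b n = sum g ({..<n} \<times> {..<n})"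
      by (simp add: T_def g_def sum_product sum.cartesian_product)
    moreover have "T (a + b) n = sum g S"
    proof -
      have "(a + b) ^ k / fact k = (\<Sum>i\<le>k. g (i, k - i))" for k
      proof -
        have "(a + b) ^ k / fact k = (\<Sum>i\<le>k. of_nat (k choose i) * a ^ i * b ^ (k - i) / fact k)"
          by (simp add: binomial_ring sum_divide_distrib)
        also have "\<dots> = (\<Sum>i\<le>k. g (i, k - i))"
          by (intro sum.cong refl) (simp add: g_def binomial_fact)
        finally show ?thesis .
      qed
      then show ?thesis
        unfolding T_def S_def using sum.triangle_reindex[of "\<lambda>i j. g (i, j)" n] by simp
    qed
    ultimately have "T a n * T b n - T (a + b) n = sum g ({..<n} \<times> {..<n} - S)"
      using S_sub by (simp add: sum_diff)
    moreover have "nabs (sum g ({..<n} \<times> {..<n} - S)) \<le> rad ^ n"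
    proof (rule nabs_sum_le)
      fix x assume "x \<in> {..<n} \<times> {..<n} - S"
      then obtain i j where x: "x = (i, j)" "n \<le> i + j" by (auto simp: S_def)
      have "nabs (g x) \<le> rad ^ i * rad ^ j"
        unfolding x g_def prod.case nabs_mult
        using rad_pos nabs_power_div_fact_le assms by (intro mult_mono) auto
      also have "\<dots> \<le> rad ^ n"
        unfolding power_add[symmetric] using x rad_pos rad_less_1 by (intro power_decreasing) auto
      finally show "nabs (g x) \<le> rad ^ n" .
    qed (use rad_pos in simp)
    ultimately show ?thesis by simp
  qed
  \<comment> \<open>A null sequence dominating the defect of the addition formula: the three
    truncation errors and the bound from \<open>trunc\<close>.\<close>
  let ?d = "\<lambda>n. nabs (T a n - kexp a) + nabs (T b n - kexp b) + nabs (T (a + b) n - kexp (a + b)) + rad ^ n"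
  have "?d \<longlonglongrightarrow> 0 + 0 + 0 + 0"
    using lim assms ab rad_pos rad_less_1 by (intro tendsto_add LIMSEQ_power_zero) auto
  moreover have "nabs (kexp a * kexp b - kexp (a + b)) \<le> ?d n" for n
  proof -
    have split: "kexp a * kexp b - kexp (a + b)
        = ((kexp a - T a n) * kexp b + T a n * (kexp b - T b n))
          + ((T a n * T b n - T (a + b) n) + (T (a + b) n - kexp (a + b)))"
      by (simp add: algebra_simps)
    have A: "nabs ((kexp a - T a n) * kexp b) \<le> ?d n"
      using nabs_kexp[OF assms(2)] rad_pos by (simp add: nabs_mult nabs_minus_commute)
    have "nabs (T a n * (kexp b - T b n)) \<le> nabs (T b n - kexp b)"
      using mult_left_le_one_le[OF nabs_nonneg nabs_nonneg T_le[OF assms(1)]]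
      by (simp add: nabs_mult nabs_minus_commute)
    then have B: "nabs (T a n * (kexp b - T b n)) \<le> ?d n"
      using rad_pos zero_le_power[of rad n] nabs_nonneg[of "T a n - kexp a"]
        nabs_nonneg[of "T (a + b) n - kexp (a + b)"] by linarith
    have C: "nabs (T a n * T b n - T (a + b) n) \<le> ?d n"
      using trunc[of n] nabs_nonneg[of "T a n - kexp a"] nabs_nonneg[of "T b n - kexp b"]
        nabs_nonneg[of "T (a + b) n - kexp (a + b)"] by linarith
    have D: "nabs (T (a + b) n - kexp (a + b)) \<le> ?d n"
      using rad_pos by simp
    show ?thesis unfolding split using A B C D by (intro nabs_add_bound)
  qed
  ultimately have "nabs (kexp a * kexp b - kexp (a + b)) \<le> 0"
    by (intro LIMSEQ_le_const[of ?d]) auto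
  then show ?thesis using nabs_nonneg[of "kexp a * kexp b - kexp (a + b)"]
    by (metis nabs_eq_0_iff order_antisym right_minus_eq)
qed

lemma kexp_of_nat_mult:
  assumes "nabs a < 1"
  shows "kexp (of_nat n * a) = kexp a ^ n"
proof (induction n)
  case (Suc n)
  have "kexp (a + of_nat n * a) = kexp a * kexp (of_nat n * a)"
    using assms nabs_of_nat_mult_less_1 by (intro kexp_add) auto
  then show ?case using Suc by (simp add: algebra_simps)
qed simp

lemma kexp_minus:
  assumes "nabs a < 1"
  shows "kexp a * kexp (- a) = 1"
  using kexp_add[of a "- a"] assms by simp

text \<open>Writing \<open>N choose (k + 1)\<close> as \<open>N / (k + 1)\<close> times
  \<open>M choose k\<close> extracts \<open>N * u\<close> from every nonconstant term of the
  binomial expansion. The cofactor is 1 for \<open>k = 0\<close> and at most \<open>rad\<close> in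
  absolute value afterwards, so the linear term dominates.\<close>

lemma nabs_one_plus_power_minus_1:
  assumes "nabs u < 1"
  shows "nabs ((1 + u) ^ N - 1) = nabs (of_nat N) * nabs u"
proof (cases "N = 0 \<or> u = 0")
  case False
  then obtain M where N: "N = Suc M" by (cases N) auto
  define R where "R = (\<Sum>k<M. of_nat N * u * (of_nat (M choose Suc k) * (u ^ Suc k / of_nat (Suc (Suc k)))))"
  have binom: "of_nat (N choose Suc k) * u ^ Suc k
      = of_nat N * u * (of_nat (M choose k) * (u ^ k / of_nat (Suc k)))" for k
  proof -
    have "(of_nat (Suc k) :: 'k) * of_nat (N choose Suc k) = of_nat N * of_nat (M choose k)"
      using Suc_times_binomial[of k M] N by (metis of_nat_mult)
    then show ?thesis
      by (simp add: field_simps del: of_nat_Suc)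
  qed
  have "(1 + u) ^ N = (\<Sum>k\<le>N. of_nat (N choose k) * u ^ k)"
    using binomial_ring[of u 1 N] by (simp add: add.commute)
  also have "\<dots> = 1 + (\<Sum>k\<le>M. of_nat (N choose Suc k) * u ^ Suc k)"
    unfolding N by (simp only: sum.atMost_Suc_shift) simp
  also have "\<dots> = 1 + (\<Sum>k\<le>M. of_nat N * u * (of_nat (M choose k) * (u ^ k / of_nat (Suc k))))"
    by (simp only: binom)
  also have "\<dots> = 1 + of_nat N * u + R"
    unfolding R_def lessThan_Suc_atMost[symmetric] sum.lessThan_Suc_shift by simp
  finally have eq: "(1 + u) ^ N - 1 = of_nat N * u + R" by simp
  have Nu: "0 < nabs (of_nat N * u)" using False by simp
  have "nabs R \<le> nabs (of_nat N * u) * rad"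
    unfolding R_def
  proof (rule nabs_sum_le)
    fix k
    have "nabs (of_nat (M choose Suc k) * (u ^ Suc k / of_nat (Suc (Suc k)))) \<le> 1 * rad ^ Suc k"
      unfolding nabs_mult using nabs_of_nat_le_1 nabs_power_div_Suc_le[OF assms, of "Suc k"]
      by (intro mult_mono) (auto simp del: of_nat_Suc power_Suc)
    also have "\<dots> \<le> rad" using rad_power_le_1[of k] rad_pos by simp
    finally show "nabs (of_nat N * u * (of_nat (M choose Suc k) * (u ^ Suc k / of_nat (Suc (Suc k))))) \<le> nabs (of_nat N * u) * rad"
      by (subst nabs_mult) (rule mult_left_mono, simp_all del: of_nat_Suc power_Suc)
  qed (use rad_pos in simp)
  also have "\<dots> < nabs (of_nat N * u)" using Nu rad_less_1 by simp
  finally show ?thesis unfolding eq using nabs_add_eq_left by (simp add: nabs_mult)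
qed auto

text \<open>In characteristic 0 the factor \<open>nabs (of_nat N)\<close> is nonzero, so
  \<open>z - 1\<close> must vanish. This yields uniqueness of Teichmueller representatives.\<close>

lemma root_of_unity_eq_1:
  assumes "z ^ N = 1" "nabs (z - 1) < 1" "N > 0"
  shows "z = 1"
  using nabs_one_plus_power_minus_1[OF assms(2), of N] assms(1,3) by simp

section \<open>The logarithm and its inversion by the exponential\<close>

lemma plog_sums:
  assumes "nabs x < 1"
  shows "ksums nabs (\<lambda>m. (-1) ^ m * x ^ (m + 1) / of_nat (m + 1)) (plog nabs (1 + x))"
proof -
  have "nabs ((-1) ^ m * x ^ (m + 1) / of_nat (m + 1)) \<le> nabs x * rad ^ m" for m
  proof -
    have "nabs ((-1) ^ m * x ^ (m + 1) / of_nat (m + 1)) = nabs x * nabs (x ^ m / of_nat (Suc m))"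
      by (simp add: nabs_mult nabs_divide)
    then show ?thesis using nabs_power_div_Suc_le[OF assms, of m] by (simp add: mult_left_mono)
  qed
  then have "ksums nabs (\<lambda>m. (-1) ^ m * x ^ (m + 1) / of_nat (m + 1))
     (ksuminf nabs (\<lambda>m. (-1) ^ m * x ^ (m + 1) / of_nat (m + 1)))"
    using rad_pos rad_less_1 by (intro ksums_ksuminf_geometric) auto
  then show ?thesis unfolding plog_def by simp
qed

lemma nabs_plog_le:
  assumes "nabs x < 1"
  shows "nabs (plog nabs (1 + x)) \<le> nabs x"
proof (rule ksums_bound[OF plog_sums[OF assms]])
  fix m
  have "nabs ((-1) ^ m * x ^ (m + 1) / of_nat (m + 1)) = nabs x * nabs (x ^ m / of_nat (Suc m))"
    by (simp add: nabs_mult nabs_divide)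
  also have "\<dots> \<le> nabs x"
    using order_trans[OF nabs_power_div_Suc_le[OF assms, of m] rad_power_le_1] by (simp add: mult_left_le)
  finally show "nabs ((-1) ^ m * x ^ (m + 1) / of_nat (m + 1)) \<le> nabs x" .
qed

lemma nabs_plog_less_1: "nabs (y - 1) < 1 \<Longrightarrow> nabs (plog nabs y) < 1"
  using nabs_plog_le[of "y - 1"] by simp

text \<open>If \<open>M + 1\<close> is close to 0, then \<open>M\<close> is close to -1 and
  \<open>M choose j\<close> to the generalized binomial coefficient of -1, which is
  \<open>(-1) ^ j\<close>. In the induction by Pascal's rule, \<open>Suc M choose Suc j\<close> is
  \<open>Suc M / Suc j\<close> times \<open>M choose j\<close>, and the real factor \<open>j\<close>
  pays for the denominator.\<close>

lemma nabs_binomial_minus_sign_le: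
  "nabs (of_nat (M choose j) - (-1) ^ j) \<le> real j * nabs (of_nat (Suc M))"
proof (induction j)
  case (Suc j)
  have "(of_nat (Suc j) :: 'k) * of_nat (Suc M choose Suc j) = of_nat (Suc M) * of_nat (M choose j)"
    using Suc_times_binomial[of j M] by (metis of_nat_mult)
  then have "nabs (of_nat (Suc j)) * nabs (of_nat (Suc M choose Suc j))
      = nabs (of_nat (Suc M)) * nabs (of_nat (M choose j))"
    by (metis nabs_mult)
  also have "\<dots> \<le> nabs (of_nat (Suc M)) * 1"
    by (intro mult_left_mono nabs_of_nat_le_1 nabs_nonneg)
  finally have "nabs (of_nat (Suc j)) * nabs (of_nat (Suc M choose Suc j)) \<le> nabs (of_nat (Suc M))"
    by simp
  moreover have "1 / real (Suc j) * nabs (of_nat (Suc M choose Suc j))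
      \<le> nabs (of_nat (Suc j)) * nabs (of_nat (Suc M choose Suc j))"
    by (intro mult_right_mono nabs_of_nat_ge nabs_nonneg) simp
  ultimately have "1 / real (Suc j) * nabs (of_nat (Suc M choose Suc j)) \<le> nabs (of_nat (Suc M))"
    by linarith
  then have A: "nabs (of_nat (Suc M choose Suc j)) \<le> real (Suc j) * nabs (of_nat (Suc M))"
    by (simp add: field_simps del: of_nat_Suc binomial_Suc_Suc)
  have B: "nabs (of_nat (M choose j) - (-1) ^ j) \<le> real (Suc j) * nabs (of_nat (Suc M))"
    using Suc mult_right_mono[of "real j" "real (Suc j)" "nabs (of_nat (Suc M))"]
    by (auto simp del: of_nat_Suc simp: order_trans)
  have "of_nat (M choose Suc j) - (-1) ^ Suc j
      = of_nat (Suc M choose Suc j) - (of_nat (M choose j) - (-1) ^ j :: 'k)" by simp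
  then show ?case using nabs_diff_bound[OF A B] by simp
qed simp

text \<open>The logarithm is the derivative at \<open>0\<close> of \<open>N \<mapsto> (1 + x) ^ N\<close>: the \<open>k\<close>-th coefficient of
  \<open>((1 + x) ^ N - 1) / N\<close> is \<open>((N - 1) choose (k - 1)) / k\<close>, which tends to \<open>(-1) ^ (k - 1) / k\<close>.\<close>

lemma plog_approx:
  assumes "nabs x < 1"
  obtains C where "C > 0"
    "\<And>N. nabs ((1 + x) ^ N - (1 + of_nat N * plog nabs (1 + x))) \<le> C * nabs (of_nat N) ^ 2"
proof -
  \<comment> \<open>The constant bounds \<open>k * rad ^ k\<close>: the factor \<open>k\<close>
    comes from the binomial error, \<open>rad ^ k\<close> from
    \<open>x ^ k / of_nat (Suc k)\<close>.\<close>
  have "(\<lambda>k. real k * rad ^ k) \<longlonglongrightarrow> 0"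
    using powser_times_n_limit_0[of rad] rad_pos rad_less_1 by simp
  then have "Bseq (\<lambda>k. real k * rad ^ k)"
    using convergent_imp_Bseq convergentI by blast
  then obtain C where C: "C > 0" "\<And>k. norm (real k * rad ^ k) \<le> C"
    by (auto elim: BseqE)
  have C': "real k * rad ^ k \<le> C" for k using C(2)[of k] by simp
  let ?l = "\<lambda>m. (-1) ^ m * x ^ (m + 1) / of_nat (m + 1)"
  have "nabs ((1 + x) ^ N - (1 + of_nat N * plog nabs (1 + x))) \<le> C * nabs (of_nat N) ^ 2" for N
  proof (cases N)
    case (Suc M)
    \<comment> \<open>Binomial coefficients beyond \<open>N\<close> vanish, so the expansion can be
      written as a partial sum of any length \<open>n \<ge> N\<close> and compared termwise with the
      logarithm.\<close>
    have pow: "(1 + x) ^ N - 1 = of_nat N * (\<Sum>k<n. of_nat (M choose k) * x ^ (k + 1) / of_nat (k + 1))"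
      if "n \<ge> N" for n
    proof -
      have binom: "of_nat (N choose Suc k) * x ^ Suc k
          = of_nat N * (of_nat (M choose k) * x ^ (k + 1) / of_nat (k + 1))" for k
      proof -
        have "(of_nat (Suc k) :: 'k) * of_nat (N choose Suc k) = of_nat N * of_nat (M choose k)"
          using Suc_times_binomial[of k M] Suc by (metis of_nat_mult)
        then show ?thesis by (simp add: field_simps del: of_nat_Suc)
      qed
      have "(1 + x) ^ N = (\<Sum>k\<le>N. of_nat (N choose k) * x ^ k)"
        using binomial_ring[of x 1 N] by (simp add: add.commute)
      also have "\<dots> = (\<Sum>k<Suc n. of_nat (N choose k) * x ^ k)"
        using that by (intro sum.mono_neutral_left) auto
      also have "\<dots> = 1 + (\<Sum>k<n. of_nat (N choose Suc k) * x ^ Suc k)"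
        by (simp only: sum.lessThan_Suc_shift) simp
      finally show ?thesis unfolding binom by (simp add: sum_distrib_left)
    qed
    have partial: "nabs (sum ?l {..<n} - ((1 + x) ^ N - 1) / of_nat N) \<le> C * nabs (of_nat N)" if "n \<ge> N" for n
    proof -
      have "sum ?l {..<n} - ((1 + x) ^ N - 1) / of_nat N
          = (\<Sum>k<n. - (x * (of_nat (M choose k) - (-1) ^ k) * (x ^ k / of_nat (Suc k))))"
        using Suc unfolding pow[OF that]
        by (simp add: sum_subtractf[symmetric] field_simps del: of_nat_Suc)
           (intro sum.cong refl, simp add: field_simps del: of_nat_Suc)
      also have "nabs \<dots> \<le> C * nabs (of_nat N)"
      proof (rule nabs_sum_le)
        fix k
        have "nabs (- (x * (of_nat (M choose k) - (-1) ^ k) * (x ^ k / of_nat (Suc k))))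
            = nabs x * (nabs (of_nat (M choose k) - (-1) ^ k) * nabs (x ^ k / of_nat (Suc k)))"
          by (simp only: nabs_minus nabs_mult mult.assoc)
        also have "\<dots> \<le> 1 * ((real k * nabs (of_nat N)) * rad ^ k)"
          using nabs_binomial_minus_sign_le[of M k] nabs_power_div_Suc_le[OF assms, of k] assms Suc
          by (intro mult_mono) (auto simp del: of_nat_Suc)
        also have "\<dots> = (real k * rad ^ k) * nabs (of_nat N)" by simp
        also have "\<dots> \<le> C * nabs (of_nat N)" by (intro mult_right_mono C') simp
        finally show "nabs (- (x * (of_nat (M choose k) - (-1) ^ k) * (x ^ k / of_nat (Suc k)))) \<le> C * nabs (of_nat N)" .
      qed (use C in simp)
      finally show ?thesis .
    qed
    have "nabs (plog nabs (1 + x) - ((1 + x) ^ N - 1) / of_nat N) \<le> C * nabs (of_nat N)"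
      using partial C by (intro ksums_diff_bound[OF plog_sums[OF assms]])
        (auto simp: eventually_sequentially)
    then have "nabs (of_nat N) * nabs (plog nabs (1 + x) - ((1 + x) ^ N - 1) / of_nat N)
        \<le> nabs (of_nat N) * (C * nabs (of_nat N))" by (intro mult_left_mono) auto
    moreover have "of_nat N * (plog nabs (1 + x) - ((1 + x) ^ N - 1) / of_nat N)
        = (1 + of_nat N * plog nabs (1 + x)) - (1 + x) ^ N"
      using Suc by (simp add: field_simps del: of_nat_Suc)
    ultimately show ?thesis
      by (simp add: nabs_mult[symmetric] nabs_minus_commute power2_eq_square mult_ac)
  qed simp
  then show ?thesis using that C by blast
qed

text \<open>Both \<open>y ^ N\<close> and \<open>kexp (plog y) ^ N\<close> are \<open>1 + N * plog y\<close> up to \<open>O(N\<^sup>2)\<close>, whereas raising a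
  principal unit to the power \<open>N\<close> scales its distance to \<open>1\<close> by exactly \<open>nabs N\<close>.\<close>

lemma kexp_plog:
  assumes "nabs (y - 1) < 1"
  shows "kexp (plog nabs y) = y"
proof -
  define L where "L = plog nabs y"
  define w where "w = y / kexp L"
  obtain C where C: "C > 0"
    "\<And>N. nabs (y ^ N - (1 + of_nat N * L)) \<le> C * nabs (of_nat N) ^ 2"
    using plog_approx[OF assms] unfolding L_def by auto
  have L: "nabs L < 1" using nabs_plog_less_1[OF assms] by (simp add: L_def)
  have E: "nabs (kexp L) = 1" using nabs_kexp[OF L] .
  then have E0: "kexp L \<noteq> 0" by auto
  have "nabs (w - 1) = nabs ((y - 1) - (kexp L - 1))"
    using E E0 by (simp add: w_def diff_divide_distrib[symmetric] nabs_divide field_simps)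
  also have "\<dots> < 1"
    by (rule nabs_diff_less[OF assms le_less_trans[OF nabs_kexp_minus_1_le[OF L] L]])
  finally have w: "nabs (w - 1) < 1" .
  have bound: "nabs (w - 1) \<le> max C 1 * (1 / real p) ^ n" for n
  proof -
    \<comment> \<open>Powers of \<open>p\<close> make the absolute value of \<open>N\<close> tend to
      0. It can be cancelled once from the estimate below, whose right side contains its
      square.\<close>
    define N where "N = p ^ n"
    have N0: "nabs (of_nat N) > 0" using p_gt_1 by (simp add: N_def)
    have "nabs (w ^ N - 1) = nabs (y ^ N - kexp (of_nat N * L))"
    proof -
      have "w ^ N - 1 = (y ^ N - kexp L ^ N) / kexp L ^ N"
        using E0 by (simp add: w_def power_divide diff_divide_distrib)
      then show ?thesis using E by (simp add: nabs_divide nabs_power kexp_of_nat_mult[OF L])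
    qed
    also have "\<dots> \<le> max C 1 * nabs (of_nat N) ^ 2"
    proof (rule nabs_diff_trans_le)
      show "nabs (y ^ N - (1 + of_nat N * L)) \<le> max C 1 * nabs (of_nat N) ^ 2"
        using C(2)[of N] mult_right_mono[of C "max C 1" "nabs (of_nat N) ^ 2"] by simp
      show "nabs (1 + of_nat N * L - kexp (of_nat N * L)) \<le> max C 1 * nabs (of_nat N) ^ 2"
        using kexp_second_order[OF L, of N] mult_right_mono[of 1 "max C 1" "nabs (of_nat N) ^ 2"]
        by (simp add: nabs_minus_commute)
    qed
    finally have "nabs (of_nat N) * nabs (w - 1) \<le> nabs (of_nat N) * (max C 1 * nabs (of_nat N))"
      using nabs_one_plus_power_minus_1[OF w, of N] by (simp add: power2_eq_square mult_ac)
    then have "nabs (w - 1) \<le> max C 1 * nabs (of_nat N)"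
      using N0 by (rule mult_left_le_imp_le)
    then show ?thesis by (simp add: N_def nabs_power nabs_p)
  qed
  have "(\<lambda>n. max C 1 * (1 / real p) ^ n) \<longlonglongrightarrow> 0"
    using p_gt_1 by (intro tendsto_mult_right_zero LIMSEQ_power_zero) simp
  then have "nabs (w - 1) \<le> 0" using bound LIMSEQ_le_const by blast
  then have "nabs (w - 1) = 0" using nabs_nonneg[of "w - 1"] by linarith
  then have "w = 1" by simp
  then show ?thesis using E0 by (simp add: w_def L_def)
qed

end

section \<open>The closure of the rationals and the residue field\<close>

context padic_field
begin

lemma of_rat_eq_quotient:
  obtains a b :: int where "b > 0" "coprime a b" "(of_rat q :: 'k) = of_int a / of_int b"
proof -
  obtain a b where "quotient_of q = (a, b)" by (cases "quotient_of q")
  then have "b > 0" "coprime a b" "q = of_int a / of_int b"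
    by (auto simp: quotient_of_denom_pos quotient_of_coprime quotient_of_div)
  then show ?thesis using that[of b a] by (simp add: of_rat_divide)
qed

lemma nabs_of_int_powi:
  assumes "n \<noteq> 0"
  obtains k where "nabs (of_int n) = real p powi k"
proof -
  have "nabs (of_int n) = real p powi (- int (multiplicity (int p) n))"
    using nabs_of_int[OF assms] by (simp add: powr_minus powr_realpow power_int_minus)
  then show ?thesis using that by blast
qed

lemma closure_ratE:
  assumes "x \<in> padic_closure_rat nabs" "e > 0"
  obtains q where "nabs (x - of_rat q) < e"
proof -
  have "\<exists>q. nabs (x - of_rat q) < e" using assms by (simp add: padic_closure_rat_def)
  then show ?thesis using that by (elim exE)
qed

text \<open>A rational closer to \<open>x\<close> than \<open>nabs x\<close> has the same absolute
  value, so passing to the closure leaves the value group unchanged.\<close>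

lemma closure_rat_nabs:
  assumes "x \<in> padic_closure_rat nabs" "x \<noteq> 0"
  obtains k where "nabs x = real p powi k"
proof -
  have "nabs x > 0" using assms by simp
  then obtain q where "nabs (x - of_rat q) < nabs x"
    using closure_ratE[OF assms(1)] by metis
  then have q: "nabs (of_rat q) = nabs x" by (rule nabs_eq_if_close)
  obtain a b where ab: "b > 0" "(of_rat q :: 'k) = of_int a / of_int b"
    using of_rat_eq_quotient by metis
  have "a \<noteq> 0" using ab q assms(2) by auto
  obtain k where "nabs (of_int a) = real p powi k" using nabs_of_int_powi[OF \<open>a \<noteq> 0\<close>] .
  moreover obtain l where "nabs (of_int b) = real p powi l" using nabs_of_int_powi[of b] ab by blast
  ultimately have "nabs x = real p powi (k - l)"
    using q ab by (simp add: nabs_divide power_int_diff)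
  then show ?thesis using that by blast
qed

text \<open>The residue field of the closure of the rationals is the prime field: a reduced fraction
  \<open>a / b\<close> near \<open>x\<close> has denominator prime to \<open>p\<close>, and
  \<open>b\<close> is invertible modulo \<open>p\<close>.\<close>

lemma closure_rat_residue:
  assumes "x \<in> padic_closure_rat nabs" "nabs x \<le> 1"
  obtains n where "n < p" "nabs (x - of_nat n) < 1"
proof -
  obtain q where q: "nabs (x - of_rat q) < 1"
    using closure_ratE[OF assms(1) zero_less_one] .
  obtain a b where ab: "b > 0" "coprime a b" "(of_rat q :: 'k) = of_int a / of_int b"
    using of_rat_eq_quotient by metis
  have q1: "nabs (of_rat q) \<le> 1"
    using nabs_diff_bound[OF assms(2), of "x - of_rat q"] q by simp
  have b: "\<not> int p dvd b"
  proof
    assume "int p dvd b"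
    then have "\<not> int p dvd a" using ab(2) prime_p
      by (meson coprime_common_divisor not_prime_unit prime_nat_int_transfer)
    then have "nabs (of_int a) = 1" by (rule nabs_of_int_eq_1)
    moreover have "nabs (of_int b) < 1" "nabs (of_int b) > 0"
      using \<open>int p dvd b\<close> ab(1) nabs_of_int_less_1_iff by auto
    ultimately show False using q1 ab(3) by (simp add: nabs_divide)
  qed
  then have "coprime b (int p)" using prime_p
    by (metis coprime_commute prime_imp_coprime prime_nat_int_transfer)
  then obtain c where c: "[b * c = 1] (mod int p)" using cong_solve_coprime_int by blast
  define n where "n = nat (a * c mod int p)"
  have n: "int n = a * c mod int p" "n < p"
    using p_gt_1 by (simp_all add: n_def nat_less_iff)
  have "[b * int n = b * (a * c)] (mod int p)" unfolding n(1) by (simp add: cong_def mod_mult_right_eq)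
  also have "b * (a * c) = a * (b * c)" by simp
  also have "[a * (b * c) = a * 1] (mod int p)" using c cong_mult[OF cong_refl] by blast
  finally have "int p dvd a - b * int n" by (simp add: cong_iff_dvd_diff dvd_diff_commute)
  then have "nabs (of_int (a - b * int n)) < 1" by (simp only: nabs_of_int_less_1_iff)
  moreover have "nabs (of_rat q - of_nat n) = nabs (of_int (a - b * int n)) / nabs (of_int b)"
    unfolding nabs_divide[symmetric] using ab by (simp add: diff_divide_distrib)
  ultimately have "nabs (of_rat q - of_nat n) < 1" using nabs_of_int_eq_1[OF b] by simp
  then have "nabs (x - of_nat n) < 1" using q nabs_diff_trans_less by blast
  then show ?thesis using that n by blast
qed

lemma powi_p_square: "(real p powi k) ^ 2 = real p powi (2 * k)"
  using power_int_mult[of "real p" k 2] by (simp add: mult.commute)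

lemma powi_p_less_1:
  assumes "real p powi k < 1"
  shows "real p powi k \<le> 1 / real p"
proof -
  have "k < 0"
  proof (rule ccontr)
    assume "\<not> k < 0"
    then have "real p powi 0 \<le> real p powi k" using p_gt_1 by (intro power_int_increasing) auto
    then show False using assms by simp
  qed
  then have "real p powi k \<le> real p powi (-1)" using p_gt_1 by (intro power_int_increasing) auto
  then show ?thesis by (simp add: power_int_minus inverse_eq_divide)
qed

lemma closure_rat_nabs_less_1:
  assumes "x \<in> padic_closure_rat nabs" "nabs x < 1"
  shows "nabs x \<le> 1 / real p"
proof (cases "x = 0")
  case False
  then obtain k where "nabs x = real p powi k" using closure_rat_nabs[OF assms(1)] by blast
  then show ?thesis using powi_p_less_1 assms(2) by simp
qed simp

lemma of_rat_closure_rat [simp]: "of_rat q \<in> padic_closure_rat nabs"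
proof -
  have "nabs (of_rat q - of_rat q) < e" if "e > 0" for e using that by simp
  then show ?thesis unfolding padic_closure_rat_def by (intro CollectI allI impI exI)
qed

lemma of_nat_closure_rat [simp]: "of_nat n \<in> padic_closure_rat nabs"
  using of_rat_closure_rat[of "of_nat n"] by simp

lemma closure_rat_add:
  assumes "x \<in> padic_closure_rat nabs" "y \<in> padic_closure_rat nabs"
  shows "x + y \<in> padic_closure_rat nabs"
  unfolding padic_closure_rat_def
proof (intro CollectI allI impI)
  fix e :: real assume "e > 0"
  obtain q r where "nabs (x - of_rat q) < e" "nabs (y - of_rat r) < e"
    using closure_ratE[OF assms(1) \<open>e > 0\<close>] closure_ratE[OF assms(2) \<open>e > 0\<close>] by metis
  then have "nabs ((x - of_rat q) + (y - of_rat r)) < e" by (rule nabs_add_less)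
  then show "\<exists>q. nabs (x + y - of_rat q) < e"
    by (intro exI[of _ "q + r"]) (simp add: of_rat_add algebra_simps)
qed

lemma closure_rat_mult:
  assumes "x \<in> padic_closure_rat nabs" "y \<in> padic_closure_rat nabs"
  shows "x * y \<in> padic_closure_rat nabs"
  unfolding padic_closure_rat_def
proof (intro CollectI allI impI)
  fix e :: real assume "e > 0"
  \<comment> \<open>The accuracy of \<open>r\<close> depends on \<open>q\<close> because the second
    error term is \<open>y - r\<close> times \<open>q\<close>; the summand 1 keeps the denominators
    positive.\<close>
  then have "e / (nabs y + 1) > 0" using nabs_nonneg[of y] by (intro divide_pos_pos) linarith+
  then obtain q where q: "nabs (x - of_rat q) < e / (nabs y + 1)"
    using closure_ratE[OF assms(1)] by metis
  have "e / (nabs (of_rat q) + 1) > 0" using nabs_nonneg[of "of_rat q"] \<open>e > 0\<close> by (intro divide_pos_pos) linarith+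
  then obtain r where r: "nabs (y - of_rat r) < e / (nabs (of_rat q) + 1)"
    using closure_ratE[OF assms(2)] by metis
  have aux: "a * c < e" if "a < e / (c + 1)" "0 \<le> a" "0 \<le> c" for a c :: real
  proof -
    have "a * (c + 1) < e" using that by (simp add: field_simps)
    then show ?thesis using that by (simp add: algebra_simps)
  qed
  have "nabs ((x - of_rat q) * y) < e" "nabs ((y - of_rat r) * of_rat q) < e"
    unfolding nabs_mult using q r by (auto intro!: aux)
  then have "nabs ((x - of_rat q) * y + (y - of_rat r) * of_rat q) < e" by (rule nabs_add_less)
  then show "\<exists>q. nabs (x * y - of_rat q) < e"
    by (intro exI[of _ "q * r"]) (simp add: of_rat_mult algebra_simps)
qed

lemma closure_rat_inverse:
  assumes "x \<in> padic_closure_rat nabs"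
  shows "inverse x \<in> padic_closure_rat nabs"
proof (cases "x = 0")
  case True
  then show ?thesis using assms by simp
next
  case False
  then have x: "nabs x > 0" by simp
  show ?thesis unfolding padic_closure_rat_def
  proof (intro CollectI allI impI)
    fix e :: real assume "e > 0"
    \<comment> \<open>The first bound forces \<open>nabs (of_rat q) = nabs x\<close>; the second
      then controls the difference of the inverses.\<close>
    then have "min (nabs x) (e * nabs x ^ 2) > 0" using x by simp
    then obtain q where "nabs (x - of_rat q) < min (nabs x) (e * nabs x ^ 2)"
      using closure_ratE[OF assms] by metis
    then have q: "nabs (x - of_rat q) < nabs x" "nabs (x - of_rat q) < e * nabs x ^ 2" by auto
    have qx: "nabs (of_rat q) = nabs x" using nabs_eq_if_close[OF q(1)] .
    then have q0: "(of_rat q :: 'k) \<noteq> 0" using x by auto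
    have "inverse x - of_rat (inverse q) = (of_rat q - x) / (x * of_rat q)"
      unfolding of_rat_inverse using False q0 by (simp add: divide_simps)
    then have "nabs (inverse x - of_rat (inverse q)) = nabs (x - of_rat q) / nabs x ^ 2"
      by (simp add: nabs_divide nabs_mult qx power2_eq_square nabs_minus_commute)
    also have "\<dots> < e" using q(2) x by (simp add: pos_divide_less_eq)
    finally show "\<exists>q. nabs (inverse x - of_rat q) < e" by blast
  qed
qed

lemma closure_rat_divide:
  "x \<in> padic_closure_rat nabs \<Longrightarrow> y \<in> padic_closure_rat nabs \<Longrightarrow> x / y \<in> padic_closure_rat nabs"
  unfolding divide_inverse by (intro closure_rat_mult closure_rat_inverse)

end

section \<open>Counting the residue field; Frobenius modulo the maximal ideal\<close>

lemma (in ultrametric_field) res_card_eq_card: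
  assumes le: "\<And>r. r \<in> R \<Longrightarrow> nabs r \<le> 1"
    and inj: "\<And>r r'. r \<in> R \<Longrightarrow> r' \<in> R \<Longrightarrow> nabs (r - r') < 1 \<Longrightarrow> r = r'"
    and surj: "\<And>x. nabs x \<le> 1 \<Longrightarrow> \<exists>r\<in>R. nabs (x - r) < 1"
  shows "res_card nabs = card R"
proof -
  define A where "A = {x. nabs x \<le> 1}"
  define E where "E = {(x, y). nabs x \<le> 1 \<and> nabs y \<le> 1 \<and> nabs (x - y) < 1}"
  have "equiv A E"
    unfolding A_def E_def equiv_def refl_on_def sym_def trans_def
    by (auto simp: nabs_minus_commute intro: nabs_diff_trans_less)
  have "bij_betw (\<lambda>r. E `` {r}) R (A // E)"
    unfolding bij_betw_def
  proof
    show "inj_on (\<lambda>r. E `` {r}) R"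
    proof
      fix r r' assume r: "r \<in> R" "r' \<in> R" and "E `` {r} = E `` {r'}"
      then have "(r, r') \<in> E" using le \<open>equiv A E\<close> eq_equiv_class_iff[of A E r r'] by (auto simp: A_def)
      then show "r = r'" using inj r by (auto simp: E_def)
    qed
    show "(\<lambda>r. E `` {r}) ` R = A // E"
    proof
      show "(\<lambda>r. E `` {r}) ` R \<subseteq> A // E" using le by (auto simp: A_def quotient_def)
      show "A // E \<subseteq> (\<lambda>r. E `` {r}) ` R"
      proof
        fix c assume "c \<in> A // E"
        then obtain x where x: "nabs x \<le> 1" "c = E `` {x}" by (auto simp: A_def quotient_def)
        then obtain r where "r \<in> R" "nabs (x - r) < 1" using surj by blast
        then have "(x, r) \<in> E" using x le by (auto simp: E_def)
        then have "c = E `` {r}" using x \<open>equiv A E\<close> equiv_class_eq by metis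
        then show "c \<in> (\<lambda>r. E `` {r}) ` R" using \<open>r \<in> R\<close> by blast
      qed
    qed
  qed
  then have "card R = card (A // E)" by (rule bij_betw_same_card)
  then show ?thesis by (simp add: res_card_def A_def E_def)
qed

context padic_field
begin

lemma nat_eq_if_close:
  assumes "m < p" "n < p" "nabs (of_nat m - of_nat n) < 1"
  shows "m = n"
proof -
  have "nabs (of_int (int m - int n)) < 1" using assms by simp
  then have "int p dvd int m - int n" by (simp only: nabs_of_int_less_1_iff)
  then have "[m = n] (mod p)" by (metis cong_iff_dvd_diff cong_int_iff)
  then show ?thesis using assms by (simp add: cong_less_modulus_unique_nat)
qed

lemma res_card_eq_p:
  assumes "\<And>x. nabs x \<le> 1 \<Longrightarrow> \<exists>n<p. nabs (x - of_nat n) < 1"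
  shows "res_card nabs = p"
proof -
  have "res_card nabs = card (of_nat ` {..<p} :: 'k set)"
    by (rule res_card_eq_card) (use assms nat_eq_if_close in \<open>auto simp: nabs_of_nat_le_1 Bex_def\<close>)
  also have "\<dots> = p" by (simp add: card_image inj_on_def)
  finally show ?thesis .
qed

lemma nabs_power_p_minus_self: "nabs (of_nat r ^ p - of_nat r) < 1"
proof -
  have "[r ^ p = r] (mod p)"
  proof (cases "p dvd r")
    case True
    then have "p dvd r ^ p" using dvd_trans[OF _ dvd_power[of p r]] p_pos by blast
    then show ?thesis using True by (simp add: cong_def)
  next
    case False
    then have "[r * r ^ (p - 1) = r * 1] (mod p)"
      using prime_p by (intro cong_mult cong_refl fermat_theorem)
    then show ?thesis using p_pos power_Suc[of r "p - 1"] by simp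
  qed
  then have "int p dvd int (r ^ p) - int r" using cong_iff_dvd_diff cong_int_iff by blast
  then have "nabs (of_int (int (r ^ p) - int r)) < 1" by (simp only: nabs_of_int_less_1_iff)
  then show ?thesis by simp
qed

lemma power_p_close_if_close_nat:
  assumes "nabs x \<le> 1" "nabs (x - of_nat n) < 1"
  shows "nabs (x ^ p - x) < 1"
proof -
  have "nabs (x ^ p - of_nat n ^ p) < 1"
    using nabs_power_diff_le[OF assms(1) nabs_of_nat_le_1[of n], of p] assms(2) by linarith
  then show ?thesis
    using nabs_power_p_minus_self[of n] assms(2) nabs_minus_commute nabs_diff_trans_less by metis
qed

text \<open>The inner binomial coefficients \<open>p choose k\<close> are divisible by
  \<open>p\<close>, so Frobenius is additive modulo the maximal ideal.\<close>

lemma frobenius_add: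
  assumes "nabs x \<le> 1" "nabs y \<le> 1"
  shows "nabs ((x + y) ^ p - (x ^ p + y ^ p)) < 1"
proof -
  have "(x + y) ^ p = (\<Sum>k\<le>p. of_nat (p choose k) * x ^ k * y ^ (p - k))" by (rule binomial_ring)
  also have "\<dots> = x ^ p + y ^ p + (\<Sum>k\<in>{0<..<p}. of_nat (p choose k) * x ^ k * y ^ (p - k))"
  proof -
    have "{..p} = insert 0 (insert p {0<..<p})" using p_gt_1 by auto
    then show ?thesis using p_gt_1 by simp
  qed
  finally have "(x + y) ^ p - (x ^ p + y ^ p) = (\<Sum>k\<in>{0<..<p}. of_nat (p choose k) * x ^ k * y ^ (p - k))"
    by simp
  also have "nabs \<dots> \<le> 1 / real p"
  proof (rule nabs_sum_le)
    fix k assume "k \<in> {0<..<p}"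
    then have "p dvd (p choose k)" using prime_p by (auto intro: dvd_choose_prime)
    then obtain m where "p choose k = p * m" by auto
    then have "nabs (of_nat (p choose k)) = 1 / real p * nabs (of_nat m)" by (simp add: nabs_mult nabs_p)
    then have "nabs (of_nat (p choose k)) \<le> 1 / real p"
      using nabs_of_nat_le_1[of m] p_gt_1 by (simp add: field_simps)
    then have "nabs (of_nat (p choose k)) * nabs x ^ k * nabs y ^ (p - k) \<le> 1 / real p * 1 * 1"
      using assms by (intro mult_mono) (auto simp: power_le_one)
    then show "nabs (of_nat (p choose k) * x ^ k * y ^ (p - k)) \<le> 1 / real p"
      by (simp add: nabs_mult nabs_power)
  qed simp
  also have "\<dots> < 1" using p_gt_1 by simp
  finally show ?thesis .
qed

end

section \<open>The field generated by the golden ratio\<close>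

locale Qp_phi = padic_field nabs p
  for nabs :: "'k::field_char_0 \<Rightarrow> real" and p :: nat +
  fixes phi :: 'k
  assumes p_neq_2: "p \<noteq> 2"
    and phi_square: "phi ^ 2 = phi + 1"
    and generated: "\<exists>a b. a \<in> padic_closure_rat nabs \<and> b \<in> padic_closure_rat nabs \<and> x = a + b * phi"
begin

lemma p_ge_3: "p \<ge> 3"
  using p_gt_1 p_neq_2 by linarith

lemma phi_conj: "phi * (1 - phi) = -1"
  using phi_square by (simp add: algebra_simps power2_eq_square)

text \<open>\<open>nabs phi > 1\<close> would contradict
  \<open>nabs phi ^ 2 = nabs (phi + 1)\<close>, so \<open>phi\<close> and its conjugate are
  integral; as their product is -1, both are units.\<close>

lemma nabs_phi: "nabs phi = 1" and nabs_conj_phi: "nabs (1 - phi) = 1"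
proof -
  have le: "nabs phi \<le> 1"
  proof (rule ccontr)
    assume "\<not> nabs phi \<le> 1"
    then have gt: "nabs phi > 1" by simp
    have "nabs phi * nabs phi = nabs (phi + 1)"
      using phi_square by (metis nabs_mult power2_eq_square)
    also have "\<dots> \<le> nabs phi" using gt by (intro nabs_add_bound) auto
    finally show False using gt mult_strict_left_mono[OF gt, of "nabs phi"] by linarith
  qed
  have le': "nabs (1 - phi) \<le> 1" using le by (intro nabs_diff_bound) auto
  have "nabs phi * nabs (1 - phi) = 1" using phi_conj by (metis nabs_mult nabs_minus nabs_1)
  then show "nabs phi = 1" "nabs (1 - phi) = 1"
    using le le' mult_left_le_one_le[of "nabs (1 - phi)" "nabs phi"]
      mult_left_le_one_le[of "nabs phi" "nabs (1 - phi)"] by (auto simp: mult.commute)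
qed

definition sqrt5 :: 'k where "sqrt5 = 2 * phi - 1"

lemma sqrt5_square: "sqrt5 ^ 2 = 5"
proof -
  have "sqrt5 ^ 2 = 4 * phi ^ 2 - 4 * phi + 1"
    by (simp add: sqrt5_def power2_eq_square algebra_simps)
  then show ?thesis by (simp add: phi_square)
qed

lemma sqrt5_neq_0: "sqrt5 \<noteq> 0"
  using sqrt5_square by auto

lemma nabs_sqrt5_square: "nabs sqrt5 ^ 2 = nabs 5"
  by (simp add: nabs_power[symmetric] sqrt5_square)

lemma nabs_2: "nabs 2 = 1"
proof -
  have "\<not> p dvd 2" using p_ge_3 by (auto dest: dvd_imp_le)
  then show ?thesis using nabs_of_nat_eq_1[of 2] by simp
qed

lemma nabs_sqrt5:
  assumes "p \<noteq> 5"
  shows "nabs sqrt5 = 1"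
proof -
  have "\<not> p dvd 5" using assms prime_p primes_dvd_imp_eq[of p 5] by auto
  then have "nabs 5 = 1" using nabs_of_nat_eq_1[of 5] by simp
  then show ?thesis
    using nabs_sqrt5_square nabs_nonneg[of sqrt5] by (simp add: power2_eq_1_iff)
qed

section \<open>Residue field and ramification: the split, ramified and inert cases\<close>

lemma low_ramification_if_unramified:
  assumes "nabs x \<le> 1 / real p"
  shows "nabs x ^ (p - 1) \<le> (1 / real p) ^ 2"
proof -
  have "1 / real p \<le> 1" using p_gt_1 by simp
  then have "nabs x \<le> 1" using assms by linarith
  \<comment> \<open>The exponent \<open>p - 1\<close> is at least 2 because
    \<open>p \<ge> 3\<close>.\<close>
  then have "nabs x ^ (p - 1) \<le> nabs x ^ 2"
    using p_ge_3 by (intro power_decreasing) auto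
  also have "\<dots> \<le> (1 / real p) ^ 2" using assms by (intro power_mono) auto
  finally show ?thesis .
qed

text \<open>A common conclusion for the three cases; the last conjunct is the assumption of
  \<open>low_ramification\<close>.\<close>

definition residue_structure :: bool where
  "residue_structure \<longleftrightarrow> (res_card nabs = p \<or> res_card nabs = p ^ 2)
    \<and> nabs (phi ^ res_card nabs - phi) < 1
    \<and> (\<forall>x. nabs x < 1 \<longrightarrow> nabs x ^ (p - 1) \<le> (1 / real p) ^ 2)"

text \<open>Newton's iteration \<open>q \<mapsto> (q\<^sup>2 + 1) / (2 q - 1)\<close> for \<open>x\<^sup>2 - x - 1\<close> squares the distance to \<open>phi\<close>.\<close>

lemma phi_rational_if_close_nat:
  assumes "p \<noteq> 5" "nabs (phi - of_nat r) < 1"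
  shows "phi \<in> padic_closure_rat nabs"
proof -
  define d where "d = nabs (phi - of_nat r)"
  have d: "0 \<le> d" "d < 1" using assms by (auto simp: d_def)
  \<comment> \<open>Each Newton step is credited with only one further factor \<open>d\<close>,
    which is enough for convergence.\<close>
  have approx: "\<exists>q. nabs (phi - of_rat q) \<le> d ^ Suc n" for n
  proof (induction n)
    case 0
    show ?case by (intro exI[of _ "of_nat r"]) (simp add: d_def)
  next
    case (Suc n)
    then obtain q where q: "nabs (phi - of_rat q) \<le> d ^ Suc n" by blast
    also have "d ^ Suc n \<le> d" using d power_le_one[of d n] by (simp add: mult_left_le)
    finally have qd: "nabs (phi - of_rat q) \<le> d" .
    \<comment> \<open>The denominator \<open>2 * q - 1\<close> of the Newton step is congruent to
      \<open>sqrt5\<close>, a unit because \<open>p \<noteq> 5\<close>.\<close>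
    have "nabs (2 * (of_rat q - phi)) < nabs sqrt5"
      unfolding nabs_mult nabs_2 nabs_sqrt5[OF assms(1)] using qd d by (simp add: nabs_minus_commute)
    then have "nabs (sqrt5 + 2 * (of_rat q - phi)) = nabs sqrt5" by (rule nabs_add_eq_left)
    moreover have "sqrt5 + 2 * (of_rat q - phi) = 2 * of_rat q - 1"
      by (simp add: sqrt5_def)
    ultimately have u: "nabs (2 * of_rat q - 1) = 1" using nabs_sqrt5[OF assms(1)] by metis
    then have u0: "(2 * of_rat q - 1 :: 'k) \<noteq> 0" by auto
    have "phi - of_rat ((q ^ 2 + 1) / (2 * q - 1)) = phi - (of_rat q ^ 2 + 1) / (2 * of_rat q - 1)"
      by (simp add: of_rat_divide of_rat_add of_rat_diff of_rat_mult of_rat_power)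
    also have "\<dots> = (phi * (2 * of_rat q - 1) - (of_rat q ^ 2 + 1)) / (2 * of_rat q - 1)"
      using u0 by (simp add: diff_divide_distrib)
    also have "phi * (2 * of_rat q - 1) - (of_rat q ^ 2 + 1) = - ((phi - of_rat q) ^ 2)"
      unfolding power2_diff phi_square by (simp add: algebra_simps)
    finally have "nabs (phi - of_rat ((q ^ 2 + 1) / (2 * q - 1))) = nabs (phi - of_rat q) * nabs (phi - of_rat q)"
      using u by (simp add: nabs_divide power2_eq_square nabs_mult)
    also have "\<dots> \<le> d * d ^ Suc n" using q qd d by (intro mult_mono) auto
    finally show ?case by auto
  qed
  show ?thesis unfolding padic_closure_rat_def
  proof (intro CollectI allI impI)
    fix e :: real assume "e > 0"
    obtain n where n: "d ^ n < e" using real_arch_pow_inv[OF \<open>e > 0\<close> d(2)] by blast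
    obtain q where "nabs (phi - of_rat q) \<le> d ^ Suc n" using approx by blast
    also have "\<dots> \<le> d ^ n" using d by (simp add: mult_left_le_one_le)
    finally show "\<exists>q. nabs (phi - of_rat q) < e" using n by (intro exI[of _ q]) linarith
  qed
qed

text \<open>Once \<open>phi\<close> lies in the closure of the rationals, that closure is the whole
  field; hence the residue field is prime and there is no ramification.\<close>

lemma residue_structure_split:
  assumes "p \<noteq> 5" "nabs (phi - of_nat r) < 1"
  shows residue_structure
proof -
  have all: "x \<in> padic_closure_rat nabs" for x
    using generated[of x] phi_rational_if_close_nat[OF assms] closure_rat_add closure_rat_mult by blast
  have "res_card nabs = p"
  proof (rule res_card_eq_p)
    fix x assume "nabs x \<le> 1"
    then show "\<exists>n<p. nabs (x - of_nat n) < 1" using closure_rat_residue[OF all] by metis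
  qed
  moreover have "nabs (phi ^ p - phi) < 1"
    using power_p_close_if_close_nat[OF _ assms(2)] nabs_phi by simp
  moreover have "nabs x ^ (p - 1) \<le> (1 / real p) ^ 2" if "nabs x < 1" for x
    using low_ramification_if_unramified closure_rat_nabs_less_1[OF all that] .
  ultimately show ?thesis by (simp add: residue_structure_def)
qed

text \<open>\<open>nabs sqrt5\<close> is \<open>p\<close> to the power \<open>-1 / 2\<close>. For
  nonzero \<open>c\<close> and \<open>d\<close> in the closure of the rationals,
  \<open>nabs (d * sqrt5)\<close> is therefore an odd power of its square root and
  \<open>nabs c\<close> an even one. They never agree, so the larger one is
  \<open>nabs (c + d * sqrt5)\<close>.\<close>

lemma residue_structure_ramified:
  assumes p5: "p = 5"
  shows residue_structure
proof -
  have s2: "nabs sqrt5 ^ 2 = real p powi (-1)"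
    using nabs_sqrt5_square nabs_p p5 by (simp add: power_int_minus inverse_eq_divide)
  have ds: "\<exists>k. nabs (d * sqrt5) ^ 2 = real p powi (2 * k - 1)"
    if d: "d \<in> padic_closure_rat nabs" "d \<noteq> 0" for d
  proof -
    obtain k where "nabs d = real p powi k" using closure_rat_nabs[OF d] .
    then have "nabs (d * sqrt5) ^ 2 = (real p powi k) ^ 2 * real p powi (-1)"
      by (simp add: nabs_mult power_mult_distrib s2)
    also have "\<dots> = real p powi (2 * k - 1)"
      unfolding powi_p_square by (simp add: power_int_diff power_int_minus divide_inverse)
    finally show ?thesis by blast
  qed
  have pw: "j = k" if "real p powi j = real p powi k" for j k
  proof -
    have "real p powi a < real p powi b" if "a < b" for a b :: int
      using that p_gt_1 by (intro power_int_strict_increasing) auto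
    then show ?thesis using that by (metis linorder_neqE order_less_irrefl)
  qed
  have decomp: "\<exists>c d. c \<in> padic_closure_rat nabs \<and> x = c + d * sqrt5 \<and> nabs x = max (nabs c) (nabs (d * sqrt5))
      \<and> (nabs (d * sqrt5) \<noteq> 1) \<and> (nabs (d * sqrt5) < 1 \<longrightarrow> nabs (d * sqrt5) ^ 2 \<le> 1 / real p)" for x
  proof -
    obtain a b where ab: "a \<in> padic_closure_rat nabs" "b \<in> padic_closure_rat nabs" "x = a + b * phi"
      using generated by blast
    \<comment> \<open>Coordinates for the basis \<open>1, sqrt5\<close>, from
      \<open>phi = (1 + sqrt5) / 2\<close>.\<close>
    define c d where "c = a + b / 2" and "d = b / 2"
    have two: "2 \<in> padic_closure_rat nabs" using of_nat_closure_rat[of 2] by simp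
    have cd: "c \<in> padic_closure_rat nabs" "d \<in> padic_closure_rat nabs"
      unfolding c_def d_def using ab two by (auto intro!: closure_rat_add closure_rat_divide)
    have x: "x = c + d * sqrt5" using ab by (simp add: c_def d_def sqrt5_def field_simps)
    show ?thesis
    proof (cases "d = 0")
      case True
      then show ?thesis using cd x by (intro exI[of _ c] exI[of _ d]) simp
    next
      case False
      then obtain k where k: "nabs (d * sqrt5) ^ 2 = real p powi (2 * k - 1)" using ds cd by blast
      have neq: "nabs c \<noteq> nabs (d * sqrt5)"
      proof
        assume eq: "nabs c = nabs (d * sqrt5)"
        then have "c \<noteq> 0" using False sqrt5_neq_0 by auto
        then obtain l where "nabs c = real p powi l" using closure_rat_nabs[OF cd(1)] by blast
        then have "real p powi (2 * l) = real p powi (2 * k - 1)"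
          using k eq by (metis powi_p_square)
        then have "2 * l = 2 * k - 1" by (rule pw)
        then show False by presburger
      qed
      have "nabs (d * sqrt5) \<noteq> 1"
      proof
        assume "nabs (d * sqrt5) = 1"
        then have "real p powi (2 * k - 1) = real p powi 0" using k by simp
        then have "2 * k - 1 = 0" by (rule pw)
        then show False by presburger
      qed
      moreover have "nabs (d * sqrt5) ^ 2 \<le> 1 / real p" if "nabs (d * sqrt5) < 1"
      proof -
        have "nabs (d * sqrt5) ^ 2 < 1" using that by (simp add: power_less_one_iff)
        then show ?thesis unfolding k by (rule powi_p_less_1)
      qed
      moreover have "nabs x = max (nabs c) (nabs (d * sqrt5))"
        using neq nabs_add_eq_left[of c "d * sqrt5"] nabs_add_eq_left[of "d * sqrt5" c]
        unfolding x by (auto simp: add.commute max_def)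
      ultimately show ?thesis using cd x by blast
    qed
  qed
  have res: "\<exists>n<p. nabs (x - of_nat n) < 1" if "nabs x \<le> 1" for x
  proof -
    obtain c d where cd: "c \<in> padic_closure_rat nabs" "x = c + d * sqrt5"
      "nabs x = max (nabs c) (nabs (d * sqrt5))" "nabs (d * sqrt5) \<noteq> 1"
      using decomp[of x] by blast
    then have "nabs c \<le> 1" "nabs (d * sqrt5) < 1" using that by auto
    moreover obtain n where "n < p" "nabs (c - of_nat n) < 1"
      using closure_rat_residue[OF cd(1) \<open>nabs c \<le> 1\<close>] .
    moreover have "x - of_nat n = (c - of_nat n) + d * sqrt5" using cd by simp
    ultimately show ?thesis using nabs_add_less by metis
  qed
  then have "res_card nabs = p" by (rule res_card_eq_p)
  moreover have "nabs (phi ^ p - phi) < 1"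
    using res[of phi] power_p_close_if_close_nat[of phi] nabs_phi by auto
  moreover have "nabs x ^ (p - 1) \<le> (1 / real p) ^ 2" if "nabs x < 1" for x
  proof -
    obtain c d where cd: "c \<in> padic_closure_rat nabs"
      "nabs x = max (nabs c) (nabs (d * sqrt5))" "nabs (d * sqrt5) < 1 \<longrightarrow> nabs (d * sqrt5) ^ 2 \<le> 1 / real p"
      using decomp[of x] by blast
    have "nabs c ^ 2 \<le> nabs c"
      using cd(2) that by (simp add: power2_eq_square mult_left_le)
    also have "nabs c \<le> 1 / real p" using closure_rat_nabs_less_1[OF cd(1)] cd(2) that by simp
    finally have "nabs x ^ 2 \<le> 1 / real p" using cd that by (auto simp: max_def)
    \<comment> \<open>Here \<open>p - 1 = 4\<close>, so squaring the bound for
      \<open>nabs x ^ 2\<close> is exactly what is required.\<close>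
    then have "(nabs x ^ 2) ^ 2 \<le> (1 / real p) ^ 2" by (intro power_mono) auto
    then show ?thesis using p5 by (simp flip: power_mult)
  qed
  ultimately show ?thesis by (simp add: residue_structure_def)
qed

text \<open>The conjugates of \<open>phi\<close> are permuted by the Frobenius map of the residue field.\<close>

lemma phi_power_p: "nabs (phi ^ p - phi) < 1 \<or> nabs (phi ^ p - (1 - phi)) < 1"
proof -
  \<comment> \<open>The left side is \<open>T\<^sup>2 - T - 1\<close> at \<open>T = phi ^ p\<close>;
    as \<open>phi\<^sup>2 = phi + 1\<close>, it measures the failure of Frobenius to be additive on
    \<open>phi + 1\<close>.\<close>
  have eq: "(phi ^ p - phi) * (phi ^ p - (1 - phi)) = (phi + 1) ^ p - (phi ^ p + 1 ^ p)"
  proof -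
    have "(phi ^ p - phi) * (phi ^ p - (1 - phi)) = (phi ^ 2) ^ p - phi ^ p + phi * (1 - phi)"
      by (simp add: algebra_simps power2_eq_square power_mult_distrib)
    then show ?thesis by (simp add: phi_conj phi_square)
  qed
  have "nabs (phi ^ p - phi) * nabs (phi ^ p - (1 - phi)) < 1"
    unfolding nabs_mult[symmetric] eq by (rule frobenius_add) (simp_all add: nabs_phi)
  then show ?thesis
    using mult_mono[of 1 "nabs (phi ^ p - phi)" 1 "nabs (phi ^ p - (1 - phi))"] by fastforce
qed

text \<open>Frobenius fixes the residue of \<open>phi\<close> or exchanges it with that of
  \<open>1 - phi\<close>; in both cases its square fixes it.\<close>

lemma phi_power_p_square: "nabs (phi ^ (p ^ 2) - phi) < 1"
proof -
  have le: "nabs (phi ^ p) \<le> 1" by (simp add: nabs_power nabs_phi)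
  have pp: "phi ^ (p ^ 2) = (phi ^ p) ^ p" by (simp add: power2_eq_square power_mult)
  from phi_power_p show ?thesis
  proof
    assume *: "nabs (phi ^ p - phi) < 1"
    then have "nabs ((phi ^ p) ^ p - phi ^ p) < 1"
      using nabs_power_diff_le[OF le, of phi p] nabs_phi by simp
    then show ?thesis unfolding pp using * nabs_diff_trans_less by blast
  next
    assume *: "nabs (phi ^ p - (1 - phi)) < 1"
    then have 1: "nabs ((phi ^ p) ^ p - (1 - phi) ^ p) < 1"
      using nabs_power_diff_le[OF le, of "1 - phi" p] nabs_conj_phi by simp
    have "nabs ((phi + (1 - phi)) ^ p - (phi ^ p + (1 - phi) ^ p)) < 1"
      by (rule frobenius_add) (simp_all add: nabs_phi nabs_conj_phi)
    then have 2: "nabs ((1 - phi) ^ p - (1 - phi ^ p)) < 1"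
      by (simp add: nabs_minus_commute algebra_simps)
    have 3: "nabs ((1 - phi ^ p) - phi) < 1"
      using * nabs_minus[of "(1 - phi ^ p) - phi"] by (simp add: algebra_simps)
    show ?thesis unfolding pp using 1 2 3 nabs_diff_trans_less by blast
  qed
qed

text \<open>The residues of 1 and \<open>phi\<close> are independent over the prime field, so
  \<open>nabs (a + b * phi)\<close> is the maximum of \<open>nabs a\<close> and
  \<open>nabs b\<close>. Hence the value group does not grow, and the \<open>m + n * phi\<close>
  with \<open>m, n < p\<close> represent the residue field.\<close>

lemma residue_structure_inert:
  assumes far: "\<And>n. \<not> nabs (phi - of_nat n) < 1"
  shows residue_structure
proof -
  \<comment> \<open>For integral \<open>u\<close>, a sum \<open>u + phi\<close> of absolute value
    below 1 would put \<open>phi\<close> close to a natural number representing the residue of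
    \<open>- u\<close>.\<close>
  have unit: "nabs (u + phi) = max (nabs u) 1" if u: "u \<in> padic_closure_rat nabs" for u
  proof (cases "nabs u \<le> 1")
    case True
    have "- u \<in> padic_closure_rat nabs"
      using closure_rat_mult[OF of_rat_closure_rat[of "-1"] u] by simp
    then obtain n where n: "nabs (- u - of_nat n) < 1"
      using closure_rat_residue[of "- u"] True by auto
    have "nabs (u + phi) \<le> 1" using True nabs_phi by (intro nabs_add_bound) auto
    moreover have "\<not> nabs (u + phi) < 1"
    proof
      assume "nabs (u + phi) < 1"
      then have "nabs ((u + phi) + (- u - of_nat n)) < 1" using n by (rule nabs_add_less)
      then show False using far[of n] by simp
    qed
    ultimately show ?thesis using True by simp
  next
    case False
    then show ?thesis using nabs_add_eq_left[of phi u] nabs_phi by simp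
  qed
  have nabs_max: "nabs (a + b * phi) = max (nabs a) (nabs b)"
    if "a \<in> padic_closure_rat nabs" "b \<in> padic_closure_rat nabs" for a b
  proof (cases "b = 0")
    case False
    then have "a + b * phi = b * (a / b + phi)" by (simp add: field_simps)
    then have "nabs (a + b * phi) = nabs b * max (nabs a / nabs b) 1"
      using unit[OF closure_rat_divide[OF that]] by (simp add: nabs_mult nabs_divide)
    also have "\<dots> = max (nabs a) (nabs b)" using False by (simp add: max_mult_distrib_left)
    finally show ?thesis .
  qed simp
  define R where "R = (\<lambda>(m, n). of_nat m + of_nat n * phi) ` ({..<p} \<times> {..<p})"
  have close: "m = m' \<and> n = n'"
    if "m < p" "n < p" "m' < p" "n' < p"
      "nabs ((of_nat m + of_nat n * phi) - (of_nat m' + of_nat n' * phi)) < 1" for m n m' n'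
  proof -
    have "of_nat j - of_nat j' \<in> padic_closure_rat nabs" for j j'
      using of_rat_closure_rat[of "of_nat j - of_nat j'"] by (simp add: of_rat_diff)
    then have "nabs ((of_nat m - of_nat m') + (of_nat n - of_nat n') * phi)
        = max (nabs (of_nat m - of_nat m')) (nabs (of_nat n - of_nat n'))" by (intro nabs_max)
    moreover have "(of_nat m - of_nat m') + (of_nat n - of_nat n') * phi
        = (of_nat m + of_nat n * phi) - (of_nat m' + of_nat n' * phi)" by (simp add: algebra_simps)
    ultimately have "nabs (of_nat m - of_nat m') < 1" "nabs (of_nat n - of_nat n') < 1"
      using that(5) by auto
    then show ?thesis using nat_eq_if_close that by blast
  qed
  have "res_card nabs = card R"
  proof (rule res_card_eq_card)
    show "nabs r \<le> 1" if "r \<in> R" for r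
      using that by (auto simp: R_def nabs_max nabs_of_nat_le_1)
    show "r = r'" if "r \<in> R" "r' \<in> R" "nabs (r - r') < 1" for r r'
      using that close unfolding R_def by auto
    show "\<exists>r\<in>R. nabs (x - r) < 1" if "nabs x \<le> 1" for x
    proof -
      obtain a b where ab: "a \<in> padic_closure_rat nabs" "b \<in> padic_closure_rat nabs" "x = a + b * phi"
        using generated by blast
      then have "nabs a \<le> 1" "nabs b \<le> 1" using that nabs_max by auto
      then obtain m n where mn: "m < p" "nabs (a - of_nat m) < 1" "n < p" "nabs (b - of_nat n) < 1"
        using closure_rat_residue ab by metis
      have "nabs ((a - of_nat m) + (b - of_nat n) * phi) < 1"
        using mn by (intro nabs_add_less) (auto simp: nabs_mult nabs_phi)
      then have "nabs (x - (of_nat m + of_nat n * phi)) < 1" by (simp add: ab algebra_simps)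
      then show ?thesis using mn by (force simp: R_def)
    qed
  qed
  also have "card R = p ^ 2"
  proof -
    have "inj_on (\<lambda>(m, n). of_nat m + of_nat n * phi) ({..<p} \<times> {..<p})"
    proof (rule inj_onI, clarify)
      fix m n m' n'
      assume "m < p" "n < p" "m' < p" "n' < p" "of_nat m + of_nat n * phi = of_nat m' + of_nat n' * phi"
      then show "m = m' \<and> n = n'" using close[of m n m' n'] by simp
    qed
    then show ?thesis unfolding R_def by (simp add: card_image power2_eq_square)
  qed
  finally have "res_card nabs = p ^ 2" .
  moreover have "nabs x ^ (p - 1) \<le> (1 / real p) ^ 2" if "nabs x < 1" for x
  proof (rule low_ramification_if_unramified)
    obtain a b where ab: "a \<in> padic_closure_rat nabs" "b \<in> padic_closure_rat nabs" "x = a + b * phi"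
      using generated by blast
    then show "nabs x \<le> 1 / real p"
      using that nabs_max closure_rat_nabs_less_1 by (auto simp: max_def split: if_splits)
  qed
  ultimately show ?thesis using phi_power_p_square by (simp add: residue_structure_def)
qed

lemma residue_structure: residue_structure
proof (cases "p = 5")
  case False
  show ?thesis
  proof (cases "\<exists>n. nabs (phi - of_nat n) < 1")
    case True
    then show ?thesis using residue_structure_split[OF False] by (elim exE)
  next
    case none: False
    show ?thesis using none by (intro residue_structure_inert) simp
  qed
qed (rule residue_structure_ramified)

sublocale low_ramification nabs p
  using residue_structure by unfold_locales (simp add: residue_structure_def)

end

section \<open>Teichmueller representatives and the interpolation\<close>

context low_ramification
begin

text \<open>The quotient of two candidates is a root of unity close to 1, hence equal to 1.\<close>

lemma teich_eqI:
  assumes "res_card nabs > 1" "z ^ (res_card nabs - 1) = 1" "nabs (z - x) < 1"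
  shows "teich nabs x = z"
  unfolding teich_def
proof (rule the_equality)
  have nabs_root: "nabs v = 1" if "v ^ (res_card nabs - 1) = 1" for v
    using that assms(1) nabs_power[of v "res_card nabs - 1"]
      power_eq_1_iff[of "nabs v" "res_card nabs - 1"] by simp
  show "nabs z \<le> 1 \<and> z ^ (res_card nabs - 1) = 1 \<and> nabs (z - x) < 1"
    using nabs_root[OF assms(2)] assms by simp
  fix v assume v: "nabs v \<le> 1 \<and> v ^ (res_card nabs - 1) = 1 \<and> nabs (v - x) < 1"
  have z0: "z \<noteq> 0" using nabs_root[OF assms(2)] by auto
  have "nabs (v - z) < 1"
    using v assms(3) nabs_diff_trans_less[of v x 1 z] by (simp add: nabs_minus_commute)
  moreover have "v / z - 1 = (v - z) / z" using z0 by (simp add: diff_divide_distrib)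
  ultimately have close: "nabs (v / z - 1) < 1" using nabs_root[OF assms(2)] by (simp add: nabs_divide)
  have root: "(v / z) ^ (res_card nabs - 1) = 1" unfolding power_divide using v assms(2) by simp
  have "0 < res_card nabs - 1" using assms(1) by simp
  then have "v / z = 1" by (rule root_of_unity_eq_1[OF root close])
  then show "v = z" using z0 by simp
qed

text \<open>The Teichmueller representative of \<open>x\<close> is \<open>x\<close> divided by the \<open>(q - 1)\<close>-st root of the
  principal unit \<open>x ^ (q - 1)\<close>, extracted with the exponential.\<close>

lemma teich_root_of_unity:
  assumes "res_card nabs > 1" "p dvd res_card nabs" "nabs (x ^ (res_card nabs - 1) - 1) < 1"
  shows "teich nabs x ^ (res_card nabs - 1) = 1" "nabs (teich nabs x - x) < 1"
proof -
  define m where "m = res_card nabs - 1"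
  \<comment> \<open>Chosen so that \<open>kexp (of_nat m * a)\<close> is the inverse of
    \<open>x ^ m\<close>. Dividing by \<open>m\<close> keeps \<open>a\<close> in the open unit disc:
    \<open>p\<close> divides \<open>m + 1\<close>, so \<open>m\<close> is a unit.\<close>
  define a where "a = - (plog nabs (x ^ m) / of_nat m)"
  define z where "z = x * kexp a"
  have m: "m > 0" "\<not> p dvd m"
  proof -
    show "m > 0" using assms(1) by (simp add: m_def)
    show "\<not> p dvd m"
      using assms(1,2) p_gt_1 dvd_diff_nat[of p "res_card nabs" m] by (auto simp: m_def)
  qed
  then have nm: "nabs (of_nat m) = 1" by (intro nabs_of_nat_eq_1)
  have L: "nabs (plog nabs (x ^ m)) < 1" using nabs_plog_less_1 assms(3) by (simp add: m_def)
  then have a: "nabs a < 1" by (simp add: a_def nabs_divide nm)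
  have "nabs x ^ m = 1" using nabs_eq_1_if_close_1[OF assms(3)] by (simp add: nabs_power m_def)
  then have nx: "nabs x = 1" using m power_eq_1_iff[of "nabs x" m] by simp
  have "z ^ m = x ^ m * kexp (of_nat m * a)"
    by (simp add: z_def power_mult_distrib kexp_of_nat_mult[OF a])
  also have "of_nat m * a = - plog nabs (x ^ m)" using m by (simp add: a_def)
  also have "x ^ m = kexp (plog nabs (x ^ m))" using kexp_plog assms(3) by (simp add: m_def)
  \<comment> \<open>The preceding substitution rewrites both occurrences of \<open>x ^ m\<close>,
    hence the nested logarithm, which \<open>kexp_plog\<close> collapses.\<close>
  also have "kexp (plog nabs (x ^ m)) * kexp (- plog nabs (kexp (plog nabs (x ^ m)))) = 1"
    using kexp_plog[of "x ^ m"] assms(3) kexp_minus[OF L] by (simp add: m_def)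
  finally have zm: "z ^ (res_card nabs - 1) = 1" by (simp add: m_def)
  have "z - x = x * (kexp a - 1)" by (simp add: z_def algebra_simps)
  then have zx: "nabs (z - x) < 1"
    using nabs_kexp_minus_1_le[OF a] a nx by (simp add: nabs_mult)
  have "teich nabs x = z" using assms(1) zm zx by (rule teich_eqI)
  then show "teich nabs x ^ (res_card nabs - 1) = 1" "nabs (teich nabs x - x) < 1"
    using zm zx by simp_all
qed

text \<open>The addition formula turns the estimate at 0 into Lipschitz constant 1 on the open unit
  disc.\<close>

lemma nabs_kexp_diff_le:
  assumes "nabs a < 1" "nabs b < 1"
  shows "nabs (kexp a - kexp b) \<le> nabs (a - b)"
proof -
  have ab: "nabs (a - b) < 1" using assms by (rule nabs_diff_less)
  have "kexp a = kexp b * kexp (a - b)" using kexp_add[OF assms(2) ab] by simp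
  then have "kexp a - kexp b = kexp b * (kexp (a - b) - 1)" by (simp add: algebra_simps)
  then show ?thesis using nabs_kexp_minus_1_le[OF ab] nabs_kexp[OF assms(2)] by (simp add: nabs_mult)
qed

end

section \<open>Density of residue classes in the \<open>p\<close>-adic integers\<close>

context padic_field
begin

lemma closure_int_le_1:
  assumes "x \<in> padic_closure_int nabs"
  shows "nabs x \<le> 1"
proof -
  have "\<exists>n::int. nabs (x - of_int n) < 1"
    using assms by (simp add: padic_closure_int_def)
  then obtain n :: int where "nabs (x - of_int n) < 1" by (elim exE)
  then have "nabs ((x - of_int n) + of_int n) \<le> 1"
    by (intro nabs_add_bound nabs_of_int_le_1) simp
  then show ?thesis by simp
qed

text \<open>The Chinese remainder theorem combines the class of \<open>i\<close> modulo
  \<open>m\<close> with that of an integer approximation of \<open>x\<close> modulo a high power of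
  \<open>p\<close>.\<close>

lemma residue_class_dense:
  assumes "x \<in> padic_closure_int nabs" "e > 0" "coprime m p"
  obtains n :: nat where "[n = i] (mod m)" "nabs (x - of_nat n) < e"
proof -
  obtain N :: int where N: "nabs (x - of_int N) < e"
    using assms(1,2) unfolding padic_closure_int_def by blast
  obtain k where k: "(1 / real p) ^ k < e"
    using real_arch_pow_inv[OF assms(2), of "1 / real p"] p_gt_1 by auto
  have "coprime m (p ^ k)" using assms(3) by simp
  then obtain n where n: "[n = i] (mod m)" "[n = nat (N mod int (p ^ k))] (mod (p ^ k))"
    using binary_chinese_remainder_nat by blast
  have pk: "int (p ^ k) > 0" by simp
  have "[int n = int (nat (N mod int (p ^ k)))] (mod int (p ^ k))" using n(2) cong_int_iff by blast
  also have "int (nat (N mod int (p ^ k))) = N mod int (p ^ k)" using pk by simp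
  also have "[N mod int (p ^ k) = N] (mod int (p ^ k))" by (simp add: cong_def)
  finally have "int (p ^ k) dvd N - int n" by (metis cong_iff_dvd_diff cong_sym)
  then obtain c where c: "N - int n = int (p ^ k) * c" by auto
  have "of_int N - of_nat n = (of_int (N - int n) :: 'k)" by simp
  also have "\<dots> = of_nat p ^ k * of_int c" unfolding c by simp
  finally have "nabs (of_int N - of_nat n) = (1 / real p) ^ k * nabs (of_int c)"
    by (simp add: nabs_mult nabs_power nabs_p)
  also have "\<dots> \<le> (1 / real p) ^ k" using nabs_of_int_le_1[of c] by (intro mult_left_le) auto
  finally have "nabs (of_int N - of_nat n) < e" using k by linarith
  then have "nabs (x - of_nat n) < e" using N nabs_diff_trans_less by blast
  then show ?thesis using that n by blast
qed

end

section \<open>Binet's formula and the interpolating functions\<close>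

context Qp_phi
begin

lemma binet: "of_nat (fib n) * sqrt5 = phi ^ n - (1 - phi) ^ n"
proof (induction n rule: fib.induct)
  case (3 n)
  have "phi ^ Suc (Suc n) = phi ^ Suc n + phi ^ n"
    using phi_square by (simp add: power2_eq_square algebra_simps flip: mult.assoc)
  moreover have "(1 - phi) * (1 - phi) = (1 - phi) + 1"
    using phi_square by (simp add: power2_eq_square algebra_simps)
  then have "(1 - phi) ^ Suc (Suc n) = (1 - phi) ^ Suc n + (1 - phi) ^ n"
    by (simp add: algebra_simps flip: mult.assoc)
  ultimately show ?case using 3 by (simp add: algebra_simps del: power_Suc)
qed (simp_all add: sqrt5_def)

lemma res_card_p_dvd: "p dvd res_card nabs"
  and res_card_odd: "odd (res_card nabs)"
  and res_card_gt_1: "res_card nabs > 1"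
  and phi_power_res_card: "nabs (phi ^ res_card nabs - phi) < 1"
proof -
  have rc: "res_card nabs = p \<or> res_card nabs = p ^ 2"
    and "nabs (phi ^ res_card nabs - phi) < 1"
    using residue_structure unfolding residue_structure_def by blast+
  then show "nabs (phi ^ res_card nabs - phi) < 1" by simp
  show "p dvd res_card nabs" using rc by (auto simp: power2_eq_square)
  show "odd (res_card nabs)" using rc prime_p p_ge_3 prime_odd_nat[of p] by auto
  show "res_card nabs > 1" using rc p_gt_1 one_less_power[OF p_gt_1, of 2] by auto
qed

definition omega :: 'k where "omega = teich nabs phi"

definition L :: 'k where "L = plog nabs (phi / omega)"

text \<open>Cancelling the unit \<open>phi\<close> in \<open>phi_power_res_card\<close> shows that
  \<open>phi ^ (res_card nabs - 1)\<close> is a principal unit, as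
  \<open>teich_root_of_unity\<close> requires.\<close>

lemma omega_power: "omega ^ (res_card nabs - 1) = 1"
  and omega_close: "nabs (omega - phi) < 1"
proof -
  have "phi ^ res_card nabs - phi = phi * (phi ^ (res_card nabs - 1) - 1)"
    using res_card_gt_1 power_Suc[of phi "res_card nabs - 1"] by (simp add: algebra_simps)
  then have "nabs (phi ^ (res_card nabs - 1) - 1) < 1"
    using phi_power_res_card nabs_phi by (simp add: nabs_mult)
  then show "omega ^ (res_card nabs - 1) = 1" "nabs (omega - phi) < 1"
    unfolding omega_def using teich_root_of_unity res_card_gt_1 res_card_p_dvd by blast+
qed

lemma nabs_omega: "nabs omega = 1"
  using omega_close nabs_eq_if_close[of phi omega] nabs_phi by (simp add: nabs_minus_commute)

lemma omega_neq_0: "omega \<noteq> 0"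
  using nabs_omega by auto

lemma conj_phi: "1 - phi = - (1 / phi)"
proof -
  have "phi \<noteq> 0" using nabs_phi by auto
  then show ?thesis using phi_conj by (simp add: field_simps)
qed

text \<open>The order of the residue field is odd, so the exponent is even and the sign
  disappears.\<close>

lemma conj_omega_power: "(- (1 / omega)) ^ (res_card nabs - 1) = 1"
proof -
  have "even (res_card nabs - 1)" using res_card_odd by simp
  then show ?thesis by (simp only: power_minus_even power_divide omega_power power_one div_by_1)
qed

lemma teich_conj_phi: "teich nabs (1 - phi) = - (1 / omega)"
proof (rule teich_eqI[OF res_card_gt_1])
  show "(- (1 / omega)) ^ (res_card nabs - 1) = 1" by (rule conj_omega_power)
  have "phi \<noteq> 0" using nabs_phi by auto
  then have "- (1 / omega) - (1 - phi) = (omega - phi) / (omega * phi)"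
    unfolding conj_phi using omega_neq_0 by (simp add: field_simps)
  then show "nabs (- (1 / omega) - (1 - phi)) < 1"
    using omega_close by (simp add: nabs_divide nabs_mult nabs_omega nabs_phi)
qed

lemma nabs_L: "nabs L < 1" and kexp_L: "kexp L = phi / omega"
proof -
  have "phi / omega - 1 = (phi - omega) / omega" using omega_neq_0 by (simp add: diff_divide_distrib)
  then have "nabs (phi / omega - 1) < 1"
    using omega_close by (simp add: nabs_divide nabs_omega nabs_minus_commute)
  then show "nabs L < 1" "kexp L = phi / omega"
    unfolding L_def using nabs_plog_less_1 kexp_plog by blast+
qed

lemma nabs_L_mult: "nabs x \<le> 1 \<Longrightarrow> nabs (L * x) < 1"
  using nabs_L mult_left_le[of "nabs x" "nabs L"] by (simp add: nabs_mult)

definition Fi_closed :: "nat \<Rightarrow> 'k \<Rightarrow> 'k" where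
  "Fi_closed i x = (omega ^ i * kexp (L * x) - (- (1 / omega)) ^ i * kexp (- (L * x))) / sqrt5"

lemma Fi_sums:
  assumes "nabs x \<le> 1"
  shows "ksums nabs (\<lambda>m. Fi_coeff nabs phi i m * x ^ m) (Fi_closed i x)"
proof -
  have small: "nabs (L * x) < 1" "nabs (- (L * x)) < 1" using nabs_L_mult[OF assms] by auto
  have "ksums nabs (\<lambda>m. 1 / sqrt5 * (omega ^ i * ((L * x) ^ m / fact m)
        - (- (1 / omega)) ^ i * ((- (L * x)) ^ m / fact m)))
      (1 / sqrt5 * (omega ^ i * kexp (L * x) - (- (1 / omega)) ^ i * kexp (- (L * x))))"
    by (intro ksums_cmult ksums_diff kexp_sums small)
  moreover have "1 / sqrt5 * (omega ^ i * ((L * x) ^ m / fact m)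
        - (- (1 / omega)) ^ i * ((- (L * x)) ^ m / fact m)) = Fi_coeff nabs phi i m * x ^ m" for m
  proof -
    \<comment> \<open>The sign \<open>(-1) ^ m\<close> in \<open>Fi_coeff\<close> belongs to the
      exponential of \<open>- (L * x)\<close>.\<close>
    have "(- (L * x)) ^ m = (-1) ^ m * (L * x) ^ m" by (rule power_minus)
    then show ?thesis
      unfolding Fi_coeff_def teich_conj_phi sqrt5_def[symmetric] omega_def[symmetric] L_def[symmetric]
      using sqrt5_neq_0 by (simp add: power_mult_distrib field_simps)
  qed
  ultimately show ?thesis unfolding Fi_closed_def by simp
qed

lemma Fi_eq: "nabs x \<le> 1 \<Longrightarrow> Fi nabs phi i x = Fi_closed i x"
  unfolding Fi_def using Fi_sums ksuminf_eqI by blast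

text \<open>Both exponentials have Lipschitz constant 1 and unit coefficients. The estimate serves
  twice: for continuity, and to carry integrality over from the Fibonacci values.\<close>

lemma Fi_lipschitz:
  assumes "nabs x \<le> 1" "nabs y \<le> 1"
  shows "nabs (Fi nabs phi i y - Fi nabs phi i x) \<le> nabs (y - x) / nabs sqrt5"
proof -
  have close: "nabs (L * y - L * x) \<le> nabs (y - x)"
    unfolding right_diff_distrib[symmetric] nabs_mult
    using nabs_L by (intro mult_left_le_one_le) auto
  have A: "nabs (kexp (L * y) - kexp (L * x)) \<le> nabs (y - x)"
    using nabs_kexp_diff_le[OF nabs_L_mult[OF assms(2)] nabs_L_mult[OF assms(1)]] close by linarith
  have B: "nabs (kexp (- (L * y)) - kexp (- (L * x))) \<le> nabs (y - x)"
  proof -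
    have "nabs (kexp (- (L * y)) - kexp (- (L * x))) \<le> nabs (- (L * y) - - (L * x))"
      using nabs_L_mult[OF assms(2)] nabs_L_mult[OF assms(1)] by (intro nabs_kexp_diff_le) simp_all
    also have "- (L * y) - - (L * x) = - (L * y - L * x)" by simp
    finally show ?thesis unfolding nabs_minus using close by linarith
  qed
  have "Fi nabs phi i y - Fi nabs phi i x = (omega ^ i * (kexp (L * y) - kexp (L * x))
      - (- (1 / omega)) ^ i * (kexp (- (L * y)) - kexp (- (L * x)))) / sqrt5"
    unfolding Fi_eq[OF assms(1)] Fi_eq[OF assms(2)] Fi_closed_def
    by (simp add: diff_divide_distrib right_diff_distrib)
  moreover have "nabs (omega ^ i * (kexp (L * y) - kexp (L * x))
      - (- (1 / omega)) ^ i * (kexp (- (L * y)) - kexp (- (L * x)))) \<le> nabs (y - x)"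
    using A B by (intro nabs_diff_bound) (simp_all add: nabs_mult nabs_power nabs_divide nabs_omega)
  ultimately show ?thesis by (simp add: nabs_divide divide_right_mono)
qed

text \<open>For \<open>n\<close> in the class of \<open>i\<close>, \<open>omega ^ i\<close> equals
  \<open>omega ^ n\<close> and cancels the denominator of \<open>(phi / omega) ^ n\<close>; the
  conjugate term behaves likewise, and Binet's formula remains.\<close>

lemma Fi_of_nat:
  assumes "[n = i] (mod (res_card nabs - 1))"
  shows "Fi nabs phi i (of_nat n) = of_nat (fib n)"
proof -
  have phi0: "phi \<noteq> 0" using nabs_phi by auto
  have cong_power: "z ^ n = z ^ i" if z: "z ^ (res_card nabs - 1) = 1" for z :: 'k
  proof -
    have "z ^ k = z ^ (k mod (res_card nabs - 1))" for k
    proof -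
      have "z ^ k = z ^ ((res_card nabs - 1) * (k div (res_card nabs - 1)) + k mod (res_card nabs - 1))"
        by simp
      then show ?thesis unfolding power_add power_mult z by simp
    qed
    then show ?thesis using assms by (metis cong_def)
  qed
  have E: "kexp (L * of_nat n) = (phi / omega) ^ n"
    using kexp_of_nat_mult[OF nabs_L, of n] kexp_L by (simp add: mult.commute)
  have "kexp (L * of_nat n) * kexp (- (L * of_nat n)) = 1"
    by (intro kexp_minus nabs_L_mult nabs_of_nat_le_1)
  then have E': "kexp (- (L * of_nat n)) = (omega / phi) ^ n"
    unfolding E using phi0 omega_neq_0 by (simp add: power_divide field_simps)
  have "omega ^ i = omega ^ n" using cong_power[OF omega_power] by simp
  moreover have "(- (1 / omega)) ^ i = (- (1 / omega)) ^ n"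
    using cong_power[OF conj_omega_power] by simp
  ultimately have "Fi nabs phi i (of_nat n)
      = (omega ^ n * (phi / omega) ^ n - (- (1 / omega)) ^ n * (omega / phi) ^ n) / sqrt5"
    unfolding Fi_eq[OF nabs_of_nat_le_1] Fi_closed_def E E' by simp
  also have "\<dots> = (phi ^ n - (1 - phi) ^ n) / sqrt5"
    unfolding power_mult_distrib[symmetric] conj_phi using omega_neq_0 by simp
  also have "\<dots> = of_nat (fib n)" using sqrt5_neq_0 by (simp flip: binet)
  finally show ?thesis .
qed

text \<open>\<open>x\<close> is a limit of natural numbers congruent to \<open>i\<close>, where the
  values are Fibonacci numbers; \<open>Fi_lipschitz\<close> makes these approximate the value at
  \<open>x\<close>.\<close>

lemma Fi_closure_int:
  assumes "x \<in> padic_closure_int nabs"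
  shows "Fi nabs phi i x \<in> padic_closure_int nabs"
  unfolding padic_closure_int_def
proof (intro CollectI allI impI)
  fix e :: real assume "e > 0"
  have s: "nabs sqrt5 > 0" using sqrt5_neq_0 by simp
  have "\<not> p dvd (res_card nabs - 1)"
    using res_card_p_dvd res_card_gt_1 p_gt_1 dvd_diff_nat[of p "res_card nabs" "res_card nabs - 1"] by auto
  then have "coprime (res_card nabs - 1) p"
    using prime_p by (metis coprime_commute prime_imp_coprime)
  then obtain n where n: "[n = i] (mod (res_card nabs - 1))" "nabs (x - of_nat n) < e * nabs sqrt5"
    using residue_class_dense[OF assms, of "e * nabs sqrt5"] \<open>e > 0\<close> s by (metis mult_pos_pos)
  have "nabs (Fi nabs phi i x - of_nat (fib n)) \<le> nabs (x - of_nat n) / nabs sqrt5"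
    using Fi_lipschitz[OF nabs_of_nat_le_1 closure_int_le_1[OF assms], of i n] Fi_of_nat[OF n(1)] by simp
  also have "\<dots> < e" using n(2) s by (simp add: pos_divide_less_eq)
  finally show "\<exists>n::int. nabs (Fi nabs phi i x - of_int n) < e"
    by (intro exI[of _ "int (fib n)"]) simp
qed

end

theorem theorem5p2:
  fixes p :: nat and nabs :: "'k::field_char_0 \<Rightarrow> real" and phi :: 'k and i :: nat
  assumes "prime p" and "p \<noteq> 2"
    and K: "is_Qp_phi p nabs phi"
    and "i \<le> res_card nabs - 2"
  shows "(\<forall>x \<in> padic_closure_int nabs.
            ksums nabs (\<lambda>m. Fi_coeff nabs phi i m * x ^ m) (Fi nabs phi i x)
            \<and> Fi nabs phi i x \<in> padic_closure_int nabs)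
       \<and> (\<forall>x \<in> padic_closure_int nabs. \<forall>e>0. \<exists>d>0. \<forall>y \<in> padic_closure_int nabs.
            nabs (y - x) < d \<longrightarrow> nabs (Fi nabs phi i y - Fi nabs phi i x) < e)
       \<and> (\<forall>n::nat. [n = i] (mod (res_card nabs - 1)) \<longrightarrow>
            of_nat (fib n) = Fi nabs phi i (of_nat n))"
proof -
  interpret Qp_phi nabs p phi
    using K assms(1,2) unfolding is_Qp_phi_def by unfold_locales auto
  show ?thesis
  proof (intro conjI ballI allI impI)
    fix x assume x: "x \<in> padic_closure_int nabs"
    show "ksums nabs (\<lambda>m. Fi_coeff nabs phi i m * x ^ m) (Fi nabs phi i x)"
      using Fi_sums[OF closure_int_le_1[OF x]] Fi_eq[OF closure_int_le_1[OF x]] by simp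
    show "Fi nabs phi i x \<in> padic_closure_int nabs" using x by (rule Fi_closure_int)
    fix e :: real assume "e > 0"
    have s: "nabs sqrt5 > 0" using sqrt5_neq_0 by simp
    have "nabs (Fi nabs phi i y - Fi nabs phi i x) < e"
      if "y \<in> padic_closure_int nabs" "nabs (y - x) < e * nabs sqrt5" for y
    proof -
      have "nabs (y - x) / nabs sqrt5 < e" using that(2) s by (simp add: pos_divide_less_eq)
      then show ?thesis
        using Fi_lipschitz[OF closure_int_le_1[OF x] closure_int_le_1[OF that(1)], of i] by linarith
    qed
    then show "\<exists>d>0. \<forall>y \<in> padic_closure_int nabs.
        nabs (y - x) < d \<longrightarrow> nabs (Fi nabs phi i y - Fi nabs phi i x) < e"
      \<comment> \<open>The radius compensates the Lipschitz constant
        \<open>1 / nabs sqrt5\<close>.\<close>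
      using \<open>e > 0\<close> s by (intro exI[of _ "e * nabs sqrt5"]) simp
  next
    fix n assume "[n = i] (mod (res_card nabs - 1))"
    then show "of_nat (fib n) = Fi nabs phi i (of_nat n)" by (simp add: Fi_of_nat)
  qed
qed

end
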